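(* Let $\delta_p=\frac{p^2-1}{24}$. For each prime $p$ with $5\le p\le 19$, $$q^{\delta_p}\frac{(q^p;q^p)_\infty^p}{(q;q)_\infty}=\prod_{k=1}^{(p-1)/2}\mathcal E_{a_{k,p},p}(\tau),$$ where $(a_{k,5})=(1,2)$, $(a_{k,7})=(1,2,3)$, $(a_{k,11})=(1,2,3,5,7)$, $(a_{k,13})=(1,2,3,4,5,7)$, $(a_{k,17})=(1,2,3,5,7,8,11,13)$, $(a_{k,19})=(1,2,3,4,5,7,9,11,13)$.
   Context: $q=e^{2\pi i\tau}$, $(a;q)_\infty=\prod_{j\ge0}(1-aq^j)$. For an odd Dirichlet character $\chi$ mod $p$, $E_{1,\chi}(\tau)=1+\frac{2}{L(0,\chi)}\sum_{n\ge1}\chi(n)\frac{q^n}{1-q^n}$ ($L(0,\chi)$ the value at $0$ of the analytically continued $L$-function). For $a$ coprime to $p$, $\mathcal E_{a,p}=\frac{2}{p-1}\sum_{\chi\text{ odd}}\chi(a)E_{1,\chi}$, the sum over odd characters mod $p$ (this equals $(\gamma_{21}\tau+\gamma_{22})^{-1}\mathcal E_{1,p}(\gamma\tau)$ for $\gamma\in SL(2,\mathbb Z)$ with $\gamma_{21}\equiv 0,\gamma_{22}\equiv a\pmod p$). *)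

theory Defs
  imports "HOL-Complex_Analysis.Complex_Analysis" "HOL-Computational_Algebra.Primes"
begin

definition nome :: "complex \<Rightarrow> complex" where
  "nome \<tau> = exp (2 * of_real pi * \<i> * \<tau>)"

definition qpoch_inf :: "complex \<Rightarrow> complex \<Rightarrow> complex" where
  "qpoch_inf a q = (\<Prod>j. 1 - a * q ^ j)"

text \<open>
  Characters are functions on all integers that vanish off the residues coprime to the modulus.
  Multiplicativity together with \<open>chi 1 \<noteq> 0\<close> forces \<open>chi 1 = 1\<close>.
\<close>

definition dirichlet_character :: "nat \<Rightarrow> (int \<Rightarrow> complex) \<Rightarrow> bool" where
  "dirichlet_character m chi \<longleftrightarrow>
     (\<forall>a b. chi (a * b) = chi a * chi b) \<and>
     (\<forall>a. chi (a + int m) = chi a) \<and>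
     (\<forall>a. chi a \<noteq> 0 \<longleftrightarrow> coprime a (int m))"

definition odd_dirichlet_characters :: "nat \<Rightarrow> (int \<Rightarrow> complex) set" where
  "odd_dirichlet_characters m = {chi. dirichlet_character m chi \<and> chi (-1) = -1}"

text \<open>
  The Dirichlet \<open>L\<close>-function as the entire continuation of its Dirichlet series. Such a
  continuation exists for every nonprincipal character, hence for every odd one; it is unique by
  the identity theorem. For principal characters, which have a pole at 1, the value is unspecified.
\<close>

definition dirichlet_L :: "(int \<Rightarrow> complex) \<Rightarrow> complex \<Rightarrow> complex" where
  "dirichlet_L chi = (THE f. f holomorphic_on UNIV \<and>
     (\<forall>s. Re s > 1 \<longrightarrow> f s = (\<Sum>n. chi (int (Suc n)) / of_nat (Suc n) powr s)))"

definition eisenstein_char :: "(int \<Rightarrow> complex) \<Rightarrow> complex \<Rightarrow> complex" where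
  "eisenstein_char chi \<tau> = 1 + 2 / dirichlet_L chi 0 *
     (\<Sum>n. chi (int (Suc n)) * (nome \<tau> ^ Suc n / (1 - nome \<tau> ^ Suc n)))"

definition eisenstein_res :: "int \<Rightarrow> nat \<Rightarrow> complex \<Rightarrow> complex" where
  "eisenstein_res a p \<tau> = 2 / (of_nat p - 1) *
     (\<Sum>chi\<in>odd_dirichlet_characters p. chi a * eisenstein_char chi \<tau>)"

text \<open>For primes \<open>p \<ge> 5\<close> the division is exact, since then \<open>24\<close> divides \<open>p\<^sup>2 - 1\<close>.\<close>

definition delta :: "nat \<Rightarrow> nat" where
  "delta p = (p ^ 2 - 1) div 24"

text \<open>The tuple \<open>(a\<^sub>1, a\<^sub>2, \<dots>)\<close> of length \<open>(p - 1) div 2\<close>; \<open>a\<^sub>k\<close> is the list element at position \<open>k - 1\<close>.\<close>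

definition residue_tuple :: "nat \<Rightarrow> int list" where
  "residue_tuple p =
     (if p = 5 then [1, 2]
      else if p = 7 then [1, 2, 3]
      else if p = 11 then [1, 2, 3, 5, 7]
      else if p = 13 then [1, 2, 3, 4, 5, 7]
      else if p = 17 then [1, 2, 3, 5, 7, 8, 11, 13]
      else if p = 19 then [1, 2, 3, 4, 5, 7, 9, 11, 13]
      else [])"

end

(*
  Idea: for 5 <= p <= 19 there are r, s, t such that 2 / L(0, chi) =
  1 / chi(r) + 1 / chi(s) + 1 / chi(t) - 1 / chi(r + s + t) for every odd character chi mod p.
  By orthogonality each Eisenstein series is then a combination of four logarithmic derivatives
  of a theta function, at the points q^(u r), q^(u s), q^(u t), q^(u (r + s + t)) with u inverse
  to a. A four-term addition theorem (Liouville's theorem for an elliptic function) turns this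
  combination into a quotient of theta values. As u runs over the inverses of the tuple, each of
  the seven theta arguments runs over all residues up to sign, so the product collapses to
  (q^p; q^p)^(p-1) divided by the product of the theta values at q, ..., q^((p-1)/2).
*)
theory Submission
  imports Defs "HOL-Number_Theory.Number_Theory"
begin

section \<open>Theta functions\<close>

text \<open>Why four terms, with the fourth index r + s + t: written through \<open>phi\<close> at
  nome q^p, the weight-one series of a residue class m has constant term 1/2 - m/p. The parts linear
  in m then cancel and 1 is left, which is exactly the constant of the addition theorem. The
  relation for 2 / L(0, chi) has a combinatorial core. L(0, chi) is the sum of chi(d) sawtooth(d),
  so it suffices that the number of carries in the addition of d r, d s and d t modulo p is 0 for d
  = 1, 2 for d = -1 and 1 for all other d. For a given p this is a finite check. Since
  \<open>dirichlet_L\<close> is a definite description of an entire continuation, its value at 0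
  becomes accessible only once such a continuation has been constructed. Repeated Abel summation
  does this by elementary means, without a functional equation. The power q^delta is the total of
  the exponential factors that make the theta values even under m -> p - m; those factors cancel
  within each single Eisenstein series.\<close>

lemma norm_power_less_one:
  fixes q :: "'a :: real_normed_div_algebra"
  assumes "norm q < 1" "n > 0"
  shows "norm (q ^ n) < 1"
  using assms by (simp add: norm_power power_less_one_iff)

lemma summable_norm_geometric_mult:
  fixes q :: complex
  assumes "norm q < 1"
  shows "summable (\<lambda>j. norm (a * q ^ j))"
  using assms by (auto simp: norm_mult norm_power intro!: summable_mult summable_geometric)

lemma convergent_prod_qpoch:
  fixes a q :: complex
  assumes "norm q < 1"
  shows "convergent_prod (\<lambda>j. 1 - a * q ^ j)"
  using summable_norm_geometric_mult[OF assms, of a]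
  by (intro abs_convergent_prod_imp_convergent_prod summable_imp_abs_convergent_prod) simp

text \<open>On the disc of radius R the factors differ from 1 by at most R |q|^n, a summable
  majorant free of a. Uniformity in a is what later yields holomorphy and termwise logarithmic
  differentiation.\<close>

lemma uniform_limit_qpoch_inf:
  fixes q :: complex
  assumes "norm q < 1"
  shows "uniform_limit (cball 0 R) (\<lambda>n a. \<Prod>j<n. 1 - a * q ^ j) (\<lambda>a. qpoch_inf a q) sequentially"
proof -
  have "uniformly_convergent_on (cball 0 R) (\<lambda>n a. \<Prod>j<n. 1 - a * q ^ j)"
  proof (rule uniformly_convergent_on_prod')
    show "uniformly_convergent_on (cball 0 R) (\<lambda>N a. \<Sum>n<N. norm (1 - a * q ^ n - 1))"
    proof (rule Weierstrass_m_test')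
      show "norm (norm (1 - a * q ^ n - 1)) \<le> R * norm q ^ n" if "a \<in> cball 0 R" for n a
        using that by (auto simp: norm_mult norm_power intro!: mult_right_mono)
      show "summable (\<lambda>n. R * norm q ^ n)"
        using assms by (intro summable_mult summable_geometric) auto
    qed
  qed (auto intro!: continuous_intros)
  then obtain g where g: "uniform_limit (cball 0 R) (\<lambda>n a. \<Prod>j<n. 1 - a * q ^ j) g sequentially"
    by (auto simp: uniformly_convergent_on_def)
  also have "?this \<longleftrightarrow> ?thesis"
  proof (intro uniform_limit_cong)
    fix a :: complex assume "a \<in> cball 0 R"
    hence "(\<lambda>n. \<Prod>j<Suc n. 1 - a * q ^ j) \<longlonglongrightarrow> g a"
      by (intro LIMSEQ_Suc tendsto_uniform_limitI[OF g])
    moreover have "(\<lambda>n. \<Prod>j<Suc n. 1 - a * q ^ j) \<longlonglongrightarrow> qpoch_inf a q"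
      unfolding lessThan_Suc_atMost qpoch_inf_def
      by (rule convergent_prod_LIMSEQ[OF convergent_prod_qpoch[OF assms]])
    ultimately show "g a = qpoch_inf a q"
      using LIMSEQ_unique by blast
  qed auto
  finally show ?thesis .
qed

lemma qpoch_inf_holomorphic:
  assumes "norm q < 1"
  shows "(\<lambda>a. qpoch_inf a q) holomorphic_on A"
proof (rule holomorphic_on_subset)
  show "(\<lambda>a. qpoch_inf a q) holomorphic_on UNIV"
  proof (rule holomorphic_uniform_sequence)
    fix z :: complex
    have "uniform_limit (cball z 1) (\<lambda>n a. \<Prod>j<n. 1 - a * q ^ j) (\<lambda>a. qpoch_inf a q) sequentially"
      by (rule uniform_limit_on_subset[OF uniform_limit_qpoch_inf[OF assms, of "norm z + 1"]])
         (simp add: cball_subset_cball_iff)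
    thus "\<exists>d>0. cball z d \<subseteq> UNIV \<and> uniform_limit (cball z d)
            (\<lambda>n a. \<Prod>j<n. 1 - a * q ^ j) (\<lambda>a. qpoch_inf a q) sequentially"
      by (intro exI[of _ 1]) auto
  qed (auto intro!: holomorphic_intros)
qed auto

lemma qpoch_inf_eq_0_iff:
  assumes "norm q < 1"
  shows "qpoch_inf a q = 0 \<longleftrightarrow> (\<exists>j. a * q ^ j = 1)"
proof -
  have "(\<lambda>j. 1 - a * q ^ j) has_prod qpoch_inf a q"
    unfolding qpoch_inf_def
    using convergent_prod_qpoch[OF assms] by (rule convergent_prod_has_prod)
  from has_prod_eq_0_iff[OF this] show ?thesis by force
qed

lemma qpoch_inf_LIMSEQ:
  fixes a q :: complex
  assumes "norm q < 1"
  shows "(\<lambda>n. \<Prod>j<n. 1 - a * q ^ j) \<longlonglongrightarrow> qpoch_inf a q"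
  using tendsto_uniform_limitI[OF uniform_limit_qpoch_inf[OF assms, of "norm a"], of a] by simp

lemma qpoch_inf_shift:
  assumes "norm q < 1"
  shows "qpoch_inf a q = (1 - a) * qpoch_inf (a * q) q"
proof (rule LIMSEQ_unique)
  show "(\<lambda>n. \<Prod>j<Suc n. 1 - a * q ^ j) \<longlonglongrightarrow> qpoch_inf a q"
    using qpoch_inf_LIMSEQ[OF assms] by (rule LIMSEQ_Suc)
  have "(\<lambda>n. (1 - a) * (\<Prod>j<n. 1 - (a * q) * q ^ j)) \<longlonglongrightarrow> (1 - a) * qpoch_inf (a * q) q"
    by (intro tendsto_intros qpoch_inf_LIMSEQ assms)
  also have "(\<lambda>n. (1 - a) * (\<Prod>j<n. 1 - (a * q) * q ^ j)) = (\<lambda>n. \<Prod>j<Suc n. 1 - a * q ^ j)"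
    by (simp add: prod.lessThan_Suc_shift mult_ac del: prod.lessThan_Suc)
  finally show "(\<lambda>n. \<Prod>j<Suc n. 1 - a * q ^ j) \<longlonglongrightarrow> (1 - a) * qpoch_inf (a * q) q" .
qed

text \<open>For |q| < 1 this is -a times the logarithmic derivative in a of
  \<open>qpoch_inf a q\<close>, away from its zeros.\<close>

definition lambert_sum :: "complex \<Rightarrow> complex \<Rightarrow> complex" where
  "lambert_sum q a = (\<Sum>j. a * q ^ j / (1 - a * q ^ j))"

lemma qpoch_inf_logderiv:
  assumes "norm q < 1" "qpoch_inf a q \<noteq> 0"
  shows "(\<lambda>j. a * q ^ j / (1 - a * q ^ j)) sums (- a * deriv (\<lambda>a. qpoch_inf a q) a / qpoch_inf a q)"
proof -
  have "(\<lambda>j. deriv (\<lambda>a. 1 - a * q ^ j) a / (1 - a * q ^ j)) sums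
          (deriv (\<lambda>a. qpoch_inf a q) a / qpoch_inf a q)"
    by (rule logderiv_prodinf_complex_uniform_limit[OF uniform_limit_on_subset, 
          OF uniform_limit_qpoch_inf[OF assms(1), of "norm a + 1"], of "ball 0 (norm a + 1)"])
       (use assms in \<open>auto intro!: holomorphic_intros\<close>)
  also have "(\<lambda>j. deriv (\<lambda>a. 1 - a * q ^ j) a / (1 - a * q ^ j)) = (\<lambda>j. - (q ^ j) / (1 - a * q ^ j))"
  proof
    show "deriv (\<lambda>a. 1 - a * q ^ j) a / (1 - a * q ^ j) = - (q ^ j) / (1 - a * q ^ j)" for j
      by (rule arg_cong2[of _ _ _ _ "(/)"])
         (auto intro!: DERIV_imp_deriv derivative_eq_intros)
  qed
  finally have "(\<lambda>j. - a * (- (q ^ j) / (1 - a * q ^ j))) sums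
      (- a * (deriv (\<lambda>a. qpoch_inf a q) a / qpoch_inf a q))"
    by (rule sums_mult)
  thus ?thesis by simp
qed

lemma deriv_qpoch_inf:
  assumes "norm q < 1" "qpoch_inf a q \<noteq> 0"
  shows "a * deriv (\<lambda>a. qpoch_inf a q) a = - lambert_sum q a * qpoch_inf a q"
proof -
  have "lambert_sum q a = - a * deriv (\<lambda>a. qpoch_inf a q) a / qpoch_inf a q"
    using sums_unique[OF qpoch_inf_logderiv[OF assms]] by (simp add: lambert_sum_def)
  thus ?thesis
    using assms by simp
qed

lemma lambert_sum_shift:
  assumes "norm q < 1" "qpoch_inf a q \<noteq> 0"
  shows "lambert_sum q a = a / (1 - a) + lambert_sum q (a * q)"
  using suminf_split_head[OF sums_summable[OF qpoch_inf_logderiv[OF assms]]]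
  by (simp add: lambert_sum_def mult_ac)


section \<open>The theta function and its logarithmic derivative\<close>

definition theta :: "complex \<Rightarrow> complex \<Rightarrow> complex" where
  "theta q z = qpoch_inf z q * qpoch_inf (q / z) q"

text \<open>This is \<open>- z \<theta>'(z) / \<theta>(z)\<close>; see \<open>deriv_theta_exp\<close>.\<close>

definition phi :: "complex \<Rightarrow> complex \<Rightarrow> complex" where
  "phi q z = lambert_sum q z - lambert_sum q (q / z)"

lemma theta_one [simp]: "norm q < 1 \<Longrightarrow> theta q 1 = 0"
  by (auto simp: theta_def qpoch_inf_eq_0_iff intro!: exI[of _ 0])

lemma theta_shift:
  assumes "norm q < 1" "q \<noteq> 0" "z \<noteq> 0"
  shows "theta q (z * q) = - theta q z / z"
proof -
  have 1: "theta q z = (1 - z) * qpoch_inf (z * q) q * qpoch_inf (q / z) q"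
    using qpoch_inf_shift[OF assms(1), of z] by (simp add: theta_def)
  have 2: "theta q (z * q) = qpoch_inf (z * q) q * ((1 - 1 / z) * qpoch_inf (q / z) q)"
    using qpoch_inf_shift[OF assms(1), of "1 / z"] assms by (simp add: theta_def)
  show ?thesis
    unfolding 1 2 using assms by (simp add: field_simps)
qed

lemma theta_inverse:
  assumes "norm q < 1" "z \<noteq> 0"
  shows "theta q (1 / z) = - theta q z / z"
proof -
  have 1: "theta q z = (1 - z) * qpoch_inf (z * q) q * qpoch_inf (q / z) q"
    using qpoch_inf_shift[OF assms(1), of z] by (simp add: theta_def)
  have 2: "theta q (1 / z) = (1 - 1 / z) * qpoch_inf (q / z) q * qpoch_inf (z * q) q"
    using qpoch_inf_shift[OF assms(1), of "1 / z"] assms by (simp add: theta_def mult_ac)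
  show ?thesis
    unfolding 1 2 using assms by (simp add: field_simps)
qed

lemma theta_eq_0_imp:
  assumes "norm q < 1" "q \<noteq> 0" "z \<noteq> 0" "theta q z = 0"
  shows "\<exists>n. z = q powi n"
proof -
  consider j where "z * q ^ j = 1" | j where "q / z * q ^ j = 1"
    using assms(4) by (auto simp: theta_def qpoch_inf_eq_0_iff[OF assms(1)])
  thus ?thesis
  proof cases
    case 1
    hence "z = q powi (- int j)"
      using assms by (simp add: power_int_minus field_simps)
    thus ?thesis ..
  next
    case 2
    hence "z = q powi (int (Suc j))"
      unfolding power_int_of_nat using assms by (simp add: field_simps)
    thus ?thesis ..
  qed
qed

text \<open>Logarithmic counterpart of \<open>theta_shift\<close>: the factor 1 / z there becomes
  the constant 1. In Lambert sums it is what remains of the head terms split off at z and at 1 /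
  z.\<close>

lemma phi_shift:
  assumes "norm q < 1" "q \<noteq> 0" "z \<noteq> 0" "theta q z \<noteq> 0"
  shows "phi q (z * q) = phi q z + 1"
proof -
  have nz: "qpoch_inf z q \<noteq> 0" "theta q (z * q) \<noteq> 0" "z \<noteq> 1"
    using assms theta_shift[OF assms(1-3)] by (auto simp: theta_def)
  hence nz': "qpoch_inf (1 / z) q \<noteq> 0"
    using assms by (auto simp: theta_def)
  have 1: "lambert_sum q z = z / (1 - z) + lambert_sum q (z * q)"
    by (rule lambert_sum_shift) (use assms nz in auto)
  have 2: "lambert_sum q (1 / z) = (1 / z) / (1 - 1 / z) + lambert_sum q (q / z)"
    using lambert_sum_shift[OF assms(1) nz'] by simp
  have 3: "(1 / z) / (1 - 1 / z) = - 1 / (1 - z)" "z / (1 - z) = 1 / (1 - z) - 1"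
    using nz assms by (auto simp: field_simps)
  have 4: "q / (z * q) = 1 / z"
    using assms by simp
  show ?thesis
    unfolding phi_def 4 1 2 3 by simp
qed

lemma phi_inverse:
  assumes "norm q < 1" "q \<noteq> 0" "z \<noteq> 0" "theta q z \<noteq> 0"
  shows "phi q (1 / z) = - phi q z - 1"
proof -
  have "phi q (1 / z) = lambert_sum q (1 / z) - lambert_sum q (z * q)"
    by (simp add: phi_def mult.commute[of q z])
  also have "\<dots> = - phi q (z * q)"
    using assms by (simp add: phi_def)
  finally show ?thesis
    using phi_shift[OF assms] by simp
qed

lemma holomorphic_on_qpoch_inf:
  assumes "norm q < 1" "f holomorphic_on A"
  shows "(\<lambda>w. qpoch_inf (f w) q) holomorphic_on A"
  using holomorphic_on_compose[OF assms(2) qpoch_inf_holomorphic[OF assms(1)]]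
  by (simp add: o_def)

text \<open>Composition with exp removes the singularity of theta at 0. It turns multiplication by q
  into translation by ln q and adds the true period 2 pi i, which is the setting for Liouville's
  theorem.\<close>

lemma theta_holomorphic_exp:
  assumes "norm q < 1"
  shows "(\<lambda>w. theta q (exp w)) holomorphic_on A"
  unfolding theta_def
  by (intro holomorphic_on_mult holomorphic_on_qpoch_inf assms) (auto intro!: holomorphic_intros)

lemma qpoch_inf_DERIV:
  assumes "norm q < 1"
  shows "((\<lambda>a. qpoch_inf a q) has_field_derivative deriv (\<lambda>a. qpoch_inf a q) a) (at a)"
  using holomorphic_derivI[OF qpoch_inf_holomorphic[OF assms, of UNIV]] by auto

lemma qpoch_inf_DERIV_chain:
  assumes "norm q < 1" "(f has_field_derivative f') (at w)"
  shows "((\<lambda>w. qpoch_inf (f w) q) has_field_derivative deriv (\<lambda>a. qpoch_inf a q) (f w) * f') (at w)"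
  by (rule DERIV_chain2[OF qpoch_inf_DERIV[OF assms(1)] assms(2)])

lemma divide_exp_DERIV:
  "((\<lambda>w. q / exp w) has_field_derivative - (q / exp w)) (at (w :: complex))"
  by (auto intro!: derivative_eq_intros)

lemma deriv_theta_exp:
  assumes "norm q < 1" "theta q (exp w) \<noteq> 0"
  shows "deriv (\<lambda>w. theta q (exp w)) w = - phi q (exp w) * theta q (exp w)"
proof -
  let ?P = "\<lambda>a. qpoch_inf a q"
  have nz: "?P (exp w) \<noteq> 0" "?P (q / exp w) \<noteq> 0"
    using assms by (auto simp: theta_def)
  have "((\<lambda>w. ?P (exp w) * ?P (q / exp w)) has_field_derivative
          deriv ?P (exp w) * exp w * ?P (q / exp w)
            + deriv ?P (q / exp w) * (- (q / exp w)) * ?P (exp w)) (at w)"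
    by (intro DERIV_mult qpoch_inf_DERIV_chain assms DERIV_exp divide_exp_DERIV)
  hence "deriv (\<lambda>w. theta q (exp w)) w = deriv ?P (exp w) * exp w * ?P (q / exp w)
            + deriv ?P (q / exp w) * (- (q / exp w)) * ?P (exp w)"
    unfolding theta_def by (rule DERIV_imp_deriv)
  also have "\<dots> = (exp w * deriv ?P (exp w)) * ?P (q / exp w)
            - (q / exp w * deriv ?P (q / exp w)) * ?P (exp w)"
    by simp
  also have "\<dots> = - phi q (exp w) * theta q (exp w)"
    unfolding deriv_qpoch_inf[OF assms(1) nz(1)] deriv_qpoch_inf[OF assms(1) nz(2)]
    by (simp add: phi_def theta_def algebra_simps)
  finally show ?thesis .
qed

lemma deriv_theta_exp_0:
  assumes "norm q < 1"
  shows "deriv (\<lambda>w. theta q (exp w)) 0 = - (qpoch_inf q q)\<^sup>2"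
proof -
  let ?P = "\<lambda>a. qpoch_inf a q"
  \<comment> \<open>Splitting off 1 - z makes the zero at z = 1 explicit, so the derivative is minus
    the value of the cofactor there.\<close>
  define G where "G = (\<lambda>w. ?P (exp w * q) * ?P (q / exp w))"
  have "(\<lambda>w. theta q (exp w)) = (\<lambda>w. (1 - exp w) * G w)"
    unfolding theta_def G_def by (subst qpoch_inf_shift[OF assms]) (simp add: mult_ac)
  moreover have "G holomorphic_on UNIV"
    unfolding G_def
    by (intro holomorphic_on_mult holomorphic_on_qpoch_inf assms) (auto intro!: holomorphic_intros)
  hence "(G has_field_derivative deriv G 0) (at 0)"
    by (auto intro: holomorphic_derivI)
  hence "((\<lambda>w. (1 - exp w) * G w) has_field_derivative - G 0) (at 0)"
    by (auto intro!: derivative_eq_intros)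
  ultimately show ?thesis
    by (simp add: DERIV_imp_deriv G_def power2_eq_square)
qed

lemma qpoch_inf_self_nonzero:
  assumes "norm q < 1"
  shows "qpoch_inf q q \<noteq> 0"
proof
  assume "qpoch_inf q q = 0"
  then obtain j where "q ^ Suc j = 1"
    using qpoch_inf_eq_0_iff[OF assms] by auto
  with norm_power_less_one[OF assms, of "Suc j"] show False by simp
qed

section \<open>Quotients of entire functions and Liouville's theorem for a period lattice\<close>

lemma quotient_entire:
  assumes T: "T holomorphic_on UNIV" and N: "N holomorphic_on UNIV"
    and simple: "\<And>w. T w = 0 \<Longrightarrow> deriv T w \<noteq> 0"
    and zero: "\<And>w. T w = 0 \<Longrightarrow> N w = 0"
  obtains f where "f holomorphic_on UNIV" "\<And>w. N w = f w * T w"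
proof -
  define f where "f = (\<lambda>w. if T w = 0 then deriv N w / deriv T w else N w / T w)"
  have dT: "(T has_field_derivative deriv T w) (at w)" for w
    using T by (auto intro: holomorphic_derivI)
  have dN: "(N has_field_derivative deriv N w) (at w)" for w
    using N by (auto intro: holomorphic_derivI)
  have openT: "open {w. T w \<noteq> 0}"
    using open_Collect_neq[of T "\<lambda>_. 0"] T holomorphic_on_imp_continuous_on by auto
  have hol1: "f holomorphic_on {w. T w \<noteq> 0}"
  proof -
    have "(\<lambda>w. N w / T w) holomorphic_on {w. T w \<noteq> 0}"
      by (intro holomorphic_on_divide holomorphic_on_subset[OF T] holomorphic_on_subset[OF N]) auto
    thus ?thesis
      by (rule holomorphic_transform) (auto simp: f_def)
  qed
  have "f field_differentiable at w" for w
  proof (cases "T w = 0")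
    case False
    thus ?thesis
      using holomorphic_on_imp_differentiable_at[OF hol1 openT] by simp
  next
    case True
    have nz: "deriv T w \<noteq> 0"
      using simple True by blast
    have limT: "((\<lambda>x. T x / (x - w)) \<longlongrightarrow> deriv T w) (at w)"
      using dT[of w] True by (simp add: has_field_derivative_iff)
    have limN: "((\<lambda>x. N x / (x - w)) \<longlongrightarrow> deriv N w) (at w)"
      using dN[of w] zero[OF True] by (simp add: has_field_derivative_iff)
    have "eventually (\<lambda>x. T x / (x - w) \<noteq> 0) (at w)"
      using limT nz by (rule tendsto_imp_eventually_ne)
    hence ev: "eventually (\<lambda>x. T x \<noteq> 0) (at w)"
      by eventually_elim auto
    then obtain r where r: "r > 0" "\<And>x. x \<noteq> w \<Longrightarrow> dist x w < r \<Longrightarrow> T x \<noteq> 0"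
      by (auto simp: eventually_at)
    \<comment> \<open>Both difference quotients have limits and that of T is nonzero, so N / T tends
      to N' / T'. The singularity is removable and \<open>f\<close> already takes the right value
      there.\<close>
    have "((\<lambda>x. (N x / (x - w)) / (T x / (x - w))) \<longlongrightarrow> deriv N w / deriv T w) (at w)"
      by (intro tendsto_divide limN limT nz)
    hence "(f \<longlongrightarrow> deriv N w / deriv T w) (at w)"
    proof (rule Lim_transform_eventually)
      show "eventually (\<lambda>x. (N x / (x - w)) / (T x / (x - w)) = f x) (at w)"
        using ev eventually_neq_at_within[of w w] by eventually_elim (auto simp: f_def)
    qed
    hence "(f \<longlongrightarrow> f w) (at w)"
      using True by (simp add: f_def)
    note lim = this
    have "f holomorphic_on ball w r"
    proof (rule no_isolated_singularity'[of "{w}"])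
      show "f holomorphic_on ball w r - {w}"
      proof (rule holomorphic_on_subset[OF hol1], rule subsetI)
        fix x assume "x \<in> ball w r - {w}"
        thus "x \<in> {w. T w \<noteq> 0}"
          using r(2)[of x] by (simp add: dist_commute[of x w])
      qed
      show "(f \<longlongrightarrow> f z) (at z within ball w r)" if "z \<in> {w}" for z
        using that lim by (simp add: Lim_at_imp_Lim_at_within)
    qed auto
    thus ?thesis
      using r(1) by (intro holomorphic_on_imp_differentiable_at[of _ "ball w r"]) auto
  qed
  hence "f holomorphic_on UNIV"
    by (simp add: holomorphic_on_def)
  moreover have "N w = f w * T w" for w
    using zero by (auto simp: f_def)
  ultimately show ?thesis by (rule that)
qed

text \<open>The condition \<open>Re \<omega> \<noteq> 0\<close> makes \<omega> and 2 pi i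
  independent over the reals, so all values are attained on one compact box and Liouville's theorem
  applies.\<close>

lemma doubly_periodic_entire_constant:
  assumes f: "f holomorphic_on UNIV" and \<omega>: "Re \<omega> \<noteq> 0"
    and per1: "\<And>w. f (w + \<omega>) = f w" and per2: "\<And>w. f (w + 2 * of_real pi * \<i>) = f w"
  shows "f w = f v"
proof -
  have 1: "f (w + of_int n * \<omega>) = f w" for n w
  proof (induction n rule: int_induct[of _ 0])
    case (step1 i) thus ?case using per1[of "w + of_int i * \<omega>"] by (simp add: algebra_simps)
  next
    case (step2 i) thus ?case using per1[of "w + of_int (i - 1) * \<omega>"] by (simp add: algebra_simps)
  qed auto
  have 2: "f (w + of_int n * (2 * of_real pi * \<i>)) = f w" for n w
  proof (induction n rule: int_induct[of _ 0])
    case (step1 i) thus ?case using per2[of "w + of_int i * (2 * of_real pi * \<i>)"] by (simp add: algebra_simps)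
  next
    case (step2 i) thus ?case using per2[of "w + of_int (i - 1) * (2 * of_real pi * \<i>)"] by (simp add: algebra_simps)
  qed auto
  define K where "K = cbox (Complex (- \<bar>Re \<omega>\<bar>) 0) (Complex \<bar>Re \<omega>\<bar> (2 * pi))"
  have "\<exists>v\<in>K. f w = f v" for w
  proof -
    \<comment> \<open>\<omega> may have an imaginary part, so the real part is reduced first; the
      later shift by 2 pi i leaves it alone.\<close>
    define n where "n = \<lfloor>Re w / Re \<omega>\<rfloor>"
    define v where "v = w + of_int (- n) * \<omega>"
    define m where "m = \<lfloor>Im v / (2 * pi)\<rfloor>"
    define u where "u = v + of_int (- m) * (2 * of_real pi * \<i>)"
    have "Re u = Re \<omega> * (Re w / Re \<omega> - of_int n)"
      using \<omega> by (simp add: u_def v_def algebra_simps)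
    moreover have "0 \<le> Re w / Re \<omega> - of_int n" "Re w / Re \<omega> - of_int n \<le> 1"
      unfolding n_def by linarith+
    ultimately have "\<bar>Re u\<bar> \<le> \<bar>Re \<omega>\<bar>"
      by (simp add: abs_mult mult_left_le)
    moreover have "Im u = 2 * pi * (Im v / (2 * pi) - of_int m)"
      by (simp add: u_def algebra_simps)
    moreover have "0 \<le> Im v / (2 * pi) - of_int m" "Im v / (2 * pi) - of_int m \<le> 1"
      unfolding m_def by linarith+
    ultimately have "u \<in> K"
      by (auto simp: K_def in_cbox_complex_iff mult_left_le)
    moreover have "f w = f u"
      unfolding u_def v_def 1 2 ..
    ultimately show ?thesis by blast
  qed
  hence "range f \<subseteq> f ` K" by blast
  moreover have "compact (f ` K)"
    unfolding K_def
    by (intro compact_continuous_image compact_cbox holomorphic_on_imp_continuous_on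
          holomorphic_on_subset[OF f]) auto
  ultimately have "bounded (range f)"
    using bounded_subset compact_imp_bounded by blast
  with f have "f constant_on UNIV" by (rule Liouville_theorem)
  thus ?thesis by (auto simp: constant_on_def)
qed

text \<open>N and T share the multiplier M, so N / T is doubly periodic; as it is also entire, it is
  constant. The conclusion is cross-multiplied to allow zeros of T. Zeros need to be examined only
  at the representatives S modulo the lattice.\<close>

lemma quasi_periodic_entire_proportional:
  fixes T N M :: "complex \<Rightarrow> complex"
  assumes T: "T holomorphic_on UNIV" and N: "N holomorphic_on UNIV" and M: "M holomorphic_on UNIV"
    and Mnz: "\<And>w. M w \<noteq> 0" and \<omega>: "Re \<omega> \<noteq> 0"
    and T1: "\<And>w. T (w + \<omega>) = M w * T w" and T2: "\<And>w. T (w + 2 * of_real pi * \<i>) = T w"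
    and N1: "\<And>w. N (w + \<omega>) = M w * N w" and N2: "\<And>w. N (w + 2 * of_real pi * \<i>) = N w"
    and S: "\<And>s. s \<in> S \<Longrightarrow> T s = 0 \<and> deriv T s \<noteq> 0 \<and> N s = 0"
    and zeros: "\<And>w. T w = 0 \<Longrightarrow>
      \<exists>s\<in>S. \<exists>m n. w = s + of_int m * \<omega> + of_int n * (2 * of_real pi * \<i>)"
  shows "N w * T v = N v * T w"
proof -
  let ?p = "2 * of_real pi * \<i> :: complex"
  have dT: "(T has_field_derivative deriv T w) (at w)" for w
    using T by (auto intro: holomorphic_derivI)
  have dM: "(M has_field_derivative deriv M w) (at w)" for w
    using M by (auto intro: holomorphic_derivI)
  \<comment> \<open>At a zero of T the term with \<open>deriv M\<close> drops out, so simplicity of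
    the zero is carried along the lattice.\<close>
  have dT1: "deriv T (w + \<omega>) = deriv M w * T w + M w * deriv T w" for w
  proof -
    have "((\<lambda>w. T (w + \<omega>)) has_field_derivative deriv T (w + \<omega>)) (at w)"
      using dT[of "w + \<omega>"] by (simp add: DERIV_shift)
    moreover have "((\<lambda>w. M w * T w) has_field_derivative deriv M w * T w + deriv T w * M w) (at w)"
      by (intro DERIV_mult dT dM)
    ultimately show ?thesis
      unfolding T1 by (metis DERIV_unique mult.commute)
  qed
  have dT2: "deriv T (w + ?p) = deriv T w" for w
  proof -
    have "((\<lambda>w. T (w + ?p)) has_field_derivative deriv T (w + ?p)) (at w)"
      using dT[of "w + ?p"] by (simp only: DERIV_shift)
    thus ?thesis
      unfolding T2 using dT[of w] by (metis DERIV_unique)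
  qed
  define P where "P = (\<lambda>w. T w = 0 \<and> deriv T w \<noteq> 0 \<and> N w = 0)"
  have P1: "P (w + \<omega>) \<longleftrightarrow> P w" for w
    using Mnz[of w] by (auto simp: P_def T1 N1 dT1)
  have P2: "P (w + ?p) \<longleftrightarrow> P w" for w
    unfolding P_def T2 N2 dT2 ..
  have P1': "P (w + of_int n * \<omega>) \<longleftrightarrow> P w" for n w
  proof (induction n rule: int_induct[of _ 0])
    case (step1 i) thus ?case using P1[of "w + of_int i * \<omega>"] by (simp add: algebra_simps)
  next
    case (step2 i) thus ?case using P1[of "w + of_int (i - 1) * \<omega>"] by (simp add: algebra_simps)
  qed auto
  have P2': "P (w + of_int n * ?p) \<longleftrightarrow> P w" for n w
  proof (induction n rule: int_induct[of _ 0])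
    case (step1 i) thus ?case using P2[of "w + of_int i * ?p"] by (simp add: algebra_simps)
  next
    case (step2 i) thus ?case using P2[of "w + of_int (i - 1) * ?p"] by (simp add: algebra_simps)
  qed auto
  have P: "P w" if zero: "T w = 0" for w
  proof -
    obtain s m n where s: "s \<in> S" and w: "w = s + of_int m * \<omega> + of_int n * ?p"
      using zeros[OF zero] by blast
    have "P s"
      using S[OF s] by (simp add: P_def)
    thus ?thesis
      unfolding w P1' P2' .
  qed
  have simple: "deriv T w \<noteq> 0" and zero: "N w = 0" if "T w = 0" for w
    using P[OF that] by (simp_all add: P_def)
  obtain f where f: "f holomorphic_on UNIV" "\<And>w. N w = f w * T w"
    using quotient_entire[OF T N simple zero] by blast
  have cont: "continuous (at w) f" for w
    using f(1) by (simp add: holomorphic_on_imp_continuous_on continuous_on_eq_continuous_at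
        field_differentiable_imp_continuous_at holomorphic_on_imp_differentiable_at)
  have nz: "eventually (\<lambda>x. T x \<noteq> 0) (at w)" for w
  proof (cases "T w = 0")
    case True
    have "((\<lambda>x. T x / (x - w)) \<longlongrightarrow> deriv T w) (at w)"
      using dT[of w] True by (simp add: has_field_derivative_iff)
    hence "eventually (\<lambda>x. T x / (x - w) \<noteq> 0) (at w)"
      using simple[OF True] by (rule tendsto_imp_eventually_ne)
    thus ?thesis by eventually_elim auto
  next
    case False
    have "(T \<longlongrightarrow> T w) (at w)"
      using dT[of w] DERIV_isCont isCont_def by blast
    thus ?thesis using False by (rule tendsto_imp_eventually_ne)
  qed
  \<comment> \<open>At a zero of T the equation N = f T says nothing about f. These zeros are
    isolated, so a translation identity known off them extends by continuity.\<close>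
  have ext: "f (w + c) = f w" if ev: "\<And>w. T w \<noteq> 0 \<Longrightarrow> f (w + c) = f w" for c w
  proof -
    have "((\<lambda>x. f (x + c)) \<longlongrightarrow> f (w + c)) (at w)"
      using LIM_offset[of f "f (w + c)" "w + c" c] cont[of "w + c"] by (simp add: isCont_def)
    moreover have "eventually (\<lambda>x. f (x + c) = f x) (at w)"
      using nz[of w] by eventually_elim (use ev in auto)
    ultimately have "(f \<longlongrightarrow> f (w + c)) (at w)"
      by (rule Lim_transform_eventually)
    moreover have "(f \<longlongrightarrow> f w) (at w)"
      using cont[of w] by (simp add: isCont_def)
    ultimately show ?thesis
      using LIM_unique by blast
  qed
  have "f (w + \<omega>) = f w" for w
  proof (rule ext)
    fix w assume "T w \<noteq> 0"
    have "f (w + \<omega>) * (M w * T w) = f w * (M w * T w)"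
      using f(2)[of "w + \<omega>"] f(2)[of w] T1[of w] N1[of w] by (auto simp: mult_ac)
    thus "f (w + \<omega>) = f w"
      using \<open>T w \<noteq> 0\<close> Mnz[of w] by simp
  qed
  moreover have "f (w + ?p) = f w" for w
  proof (rule ext)
    fix w assume "T w \<noteq> 0"
    have "f (w + ?p) * T w = f w * T w"
      using f(2)[of "w + ?p"] f(2)[of w] unfolding T2[of w] N2[of w] by auto
    thus "f (w + ?p) = f w"
      using \<open>T w \<noteq> 0\<close> by simp
  qed
  ultimately have "f w = f v"
    by (rule doubly_periodic_entire_constant[OF f(1) \<omega>])
  thus ?thesis
    by (simp add: f(2))
qed

text \<open>Multiplicative form of the Weierstrass identity zeta(x) + zeta(y) + zeta(z) -
  zeta(x+y+z) = sigma(x+y) sigma(y+z) sigma(z+x) / (sigma(x) sigma(y) sigma(z) sigma(x+y+z)). By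
  \<open>phi_inverse\<close> it is phi + 1/2 that is odd, and three halves less one half give the
  summand 1. For fixed b and c both sides are elliptic in a, with simple poles at 1 and 1 / (b c)
  modulo powers of q; \<open>theta q (b * c) \<noteq> 0\<close> keeps the two apart.\<close>

theorem theta_phi_addition:
  assumes q: "norm q < 1" "q \<noteq> 0" and nz: "a \<noteq> 0" "b \<noteq> 0" "c \<noteq> 0"
    and th: "theta q a \<noteq> 0" "theta q b \<noteq> 0" "theta q c \<noteq> 0" "theta q (b * c) \<noteq> 0"
            "theta q (a * b * c) \<noteq> 0"
  shows "phi q a + phi q b + phi q c - phi q (a * b * c) + 1 =
    (qpoch_inf q q)\<^sup>2 * theta q (a * b) * theta q (b * c) * theta q (a * c) /
      (theta q a * theta q b * theta q c * theta q (a * b * c))"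
proof -
  define A where "A = ln a"
  define B where "B = ln b"
  define C where "C = ln c"
  define \<omega> where "\<omega> = ln q"
  have e: "exp A = a" "exp B = b" "exp C = c" "exp \<omega> = q"
    using nz q by (simp_all add: A_def B_def C_def \<omega>_def)
  define F where "F = (\<lambda>w. theta q (exp w))"
  define D where "D = deriv F"
  have Fhol: "F holomorphic_on UNIV"
    unfolding F_def by (rule theta_holomorphic_exp[OF q(1)])
  have dF: "(F has_field_derivative D w) (at w)" for w
    unfolding D_def using Fhol by (auto intro: holomorphic_derivI)
  have Dhol: "D holomorphic_on UNIV"
    unfolding D_def using Fhol by (auto intro: holomorphic_deriv)
  have F1: "F (w + \<omega>) = - exp (- w) * F w" for w
    using theta_shift[OF q, of "exp w"] by (simp add: F_def exp_add e exp_minus field_simps)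
  have F2: "F (w + 2 * of_real pi * \<i>) = F w" for w
    by (simp add: F_def exp_add exp_two_pi_i)
  have F3: "F (- w) = - exp (- w) * F w" for w
    using theta_inverse[OF q(1), of "exp w"] by (simp add: F_def exp_minus field_simps)
  have F0: "F 0 = 0"
    using q by (simp add: F_def)
  have D1: "D (w + \<omega>) = exp (- w) * F w - exp (- w) * D w" for w
  proof -
    have "((\<lambda>w. F (w + \<omega>)) has_field_derivative D (w + \<omega>)) (at w)"
      using dF[of "w + \<omega>"] by (simp add: DERIV_shift)
    moreover have "((\<lambda>w. - exp (- w) * F w) has_field_derivative
        exp (- w) * F w - exp (- w) * D w) (at w)"
      by (auto intro!: derivative_eq_intros dF)
    ultimately show ?thesis
      unfolding F1 by (rule DERIV_unique)
  qed
  have D2: "D (w + 2 * of_real pi * \<i>) = D w" for w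
  proof -
    have "((\<lambda>w. F (w + 2 * of_real pi * \<i>)) has_field_derivative D (w + 2 * of_real pi * \<i>)) (at w)"
      using dF[of "w + 2 * of_real pi * \<i>"] by (simp only: DERIV_shift)
    thus ?thesis
      unfolding F2 using dF[of w] by (metis DERIV_unique)
  qed
  have D0: "D 0 = - (qpoch_inf q q)\<^sup>2" "D 0 \<noteq> 0"
    using deriv_theta_exp_0[OF q(1)] qpoch_inf_self_nonzero[OF q(1)] by (simp_all add: D_def F_def)
  have Dphi: "D w = - phi q (exp w) * F w" if "F w \<noteq> 0" for w
    using deriv_theta_exp[OF q(1), of w] that by (simp add: D_def F_def)
  define k where "k = phi q b + phi q c + 1"
  define \<beta> where "\<beta> = B + C"
  define r where "r = (qpoch_inf q q)\<^sup>2 * F \<beta> / (F B * F C)"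
  \<comment> \<open>T is the part of the denominators that depends on a = exp w, and N is the
    difference of the two sides times T. Writing phi as -D / F makes N entire across the zeros of
    F.\<close>
  define T where "T = (\<lambda>w. F w * F (w + \<beta>))"
  define N where "N = (\<lambda>w. - D w * F (w + \<beta>) + D (w + \<beta>) * F w + k * F w * F (w + \<beta>)
                          - r * F (w + B) * F (w + C))"
  define M where "M = (\<lambda>w. exp (- w) * exp (- (w + \<beta>)))"
  have Fnz: "F A \<noteq> 0" "F B \<noteq> 0" "F C \<noteq> 0" "F \<beta> \<noteq> 0" "F (A + \<beta>) \<noteq> 0"
    using th by (simp_all add: F_def \<beta>_def exp_add e mult.assoc)
  have shift: "(\<lambda>w. F (w + d)) holomorphic_on UNIV" "(\<lambda>w. D (w + d)) holomorphic_on UNIV" for d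
  proof -
    have w: "(\<lambda>w. w + d) holomorphic_on UNIV"
      by (intro holomorphic_intros)
    show "(\<lambda>w. F (w + d)) holomorphic_on UNIV" "(\<lambda>w. D (w + d)) holomorphic_on UNIV"
      using holomorphic_on_compose_gen[OF w Fhol] holomorphic_on_compose_gen[OF w Dhol]
      by (simp_all add: o_def)
  qed
  have dFs: "((\<lambda>w. F (w + d)) has_field_derivative D (w + d)) (at w)" for w d
    using dF[of "w + d"] by (simp only: DERIV_shift)
  have dT: "deriv T w = D w * F (w + \<beta>) + D (w + \<beta>) * F w" for w
    unfolding T_def by (intro DERIV_imp_deriv DERIV_mult dF dFs)
  \<comment> \<open>\<open>r\<close> is chosen so that \<open>N\<close> vanishes at the zeros of \<open>T\<close>; the further zero of \<open>N\<close> at \<open>- B\<close>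
    forces the proportionality constant to be 0.\<close>
  have N_eq: "N w * T v = N v * T w" for v w
  proof (rule quasi_periodic_entire_proportional[where M = M and \<omega> = \<omega> and S = "{0, - \<beta>}"])
    show "T holomorphic_on UNIV" "N holomorphic_on UNIV" "M holomorphic_on UNIV"
      unfolding T_def N_def M_def by (intro holomorphic_intros Fhol Dhol shift)+
    show "M w \<noteq> 0" for w by (simp add: M_def)
    show "Re \<omega> \<noteq> 0"
      using q by (simp add: \<omega>_def)
    have sw: "w + \<omega> + d = (w + d) + \<omega>" for w d
      by simp
    show "T (w + \<omega>) = M w * T w" for w
      unfolding T_def M_def sw F1 by (simp add: algebra_simps)
    \<comment> \<open>The shifts B and C add up to \<beta>, so this product has the same multiplier
      as T.\<close>
    have *: "F (w + B + \<omega>) * F (w + C + \<omega>) = M w * (F (w + B) * F (w + C))" for w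
    proof -
      have "exp (- (w + B)) * exp (- (w + C)) = M w"
        by (simp add: M_def \<beta>_def flip: exp_add)
      moreover have "F (w + B + \<omega>) * F (w + C + \<omega>) =
          exp (- (w + B)) * exp (- (w + C)) * (F (w + B) * F (w + C))"
        unfolding F1 by (simp only: mult_ac minus_mult_minus mult_minus_left mult_minus_right minus_minus)
      ultimately show ?thesis by simp
    qed
    show "N (w + \<omega>) = M w * N w" for w
    proof -
      have "N (w + \<omega>) = - D (w + \<omega>) * F (w + \<beta> + \<omega>) + D (w + \<beta> + \<omega>) * F (w + \<omega>)
          + k * F (w + \<omega>) * F (w + \<beta> + \<omega>) - r * (F (w + B + \<omega>) * F (w + C + \<omega>))"
        unfolding N_def sw by simp
      also have "\<dots> = M w * N w"
        unfolding * unfolding F1 D1 N_def M_def by (simp add: algebra_simps)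
      finally show ?thesis .
    qed
    have sw': "w + 2 * of_real pi * \<i> + d = (w + d) + 2 * of_real pi * \<i>" for w d :: complex
      by simp
    show "T (w + 2 * of_real pi * \<i>) = T w" "N (w + 2 * of_real pi * \<i>) = N w" for w
      unfolding T_def N_def sw' F2 D2 by (rule refl)+
    show "T s = 0 \<and> deriv T s \<noteq> 0 \<and> N s = 0" if "s \<in> {0, - \<beta>}" for s
    proof -
      consider "s = 0" | "s = - \<beta>"
        using \<open>s \<in> {0, - \<beta>}\<close> by auto
      thus ?thesis
      proof cases
        case 1
        have "N 0 = - D 0 * F \<beta> - r * F B * F C"
          by (simp add: N_def F0)
        also have "\<dots> = 0"
          using Fnz by (simp add: r_def D0(1))
        finally show ?thesis
          using 1 Fnz D0 by (simp add: T_def dT[unfolded T_def] F0)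
      next
        case 2
        have "N (- \<beta>) = D 0 * F (- \<beta>) - r * F (- C) * F (- B)"
          by (simp add: N_def F0) (simp add: \<beta>_def)
        also have "\<dots> = 0"
          unfolding F3 using Fnz by (simp add: r_def D0(1) \<beta>_def exp_add exp_diff exp_minus field_simps)
        finally have "N (- \<beta>) = 0" .
        moreover have "F (- \<beta>) \<noteq> 0"
          unfolding F3 using Fnz by simp
        ultimately show ?thesis
          using 2 Fnz D0 by (simp add: T_def dT[unfolded T_def] F0)
      qed
    qed
    have zero: "\<exists>m n. w = of_int m * \<omega> + of_int n * (2 * of_real pi * \<i>)" if Fw: "F w = 0" for w
    proof -
      obtain m where "exp w = q powi m"
        using theta_eq_0_imp[OF q, of "exp w"] Fw by (auto simp: F_def)
      hence "exp w = exp (of_int m * \<omega>)"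
        using e(4) by (metis exp_power_int mult.commute)
      then obtain n where "w = of_int m * \<omega> + of_int (2 * n) * of_real pi * \<i>"
        using exp_eq by (auto simp: mult_ac)
      hence "w = of_int m * \<omega> + of_int n * (2 * of_real pi * \<i>)"
        by (simp add: mult_ac)
      thus ?thesis by blast
    qed
    show "\<exists>s\<in>{0, - \<beta>}. \<exists>m n. w = s + of_int m * \<omega> + of_int n * (2 * of_real pi * \<i>)"
      if "T w = 0" for w
    proof (cases "F w = 0")
      case True
      with zero[of w] show ?thesis by auto
    next
      case False
      hence "F (w + \<beta>) = 0"
        using that by (simp add: T_def)
      then obtain m n where "w + \<beta> = of_int m * \<omega> + of_int n * (2 * of_real pi * \<i>)"
        using zero by blast
      hence "w = - \<beta> + of_int m * \<omega> + of_int n * (2 * of_real pi * \<i>)"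
        by (simp add: algebra_simps)
      thus ?thesis by blast
    qed
  qed
  \<comment> \<open>At a = 1 / b the product side vanishes through theta(a b) = theta(1) = 0. On the
    other side phi(1/b) + phi(b) + 1 = 0, and phi(c) cancels phi(a b c).\<close>
  have "N (- B) = 0"
  proof -
    have FB: "F (- B) \<noteq> 0"
      unfolding F3 using Fnz by simp
    have 1: "D (- B) = - phi q (1 / b) * F (- B)"
      using Dphi[OF FB] by (simp add: exp_minus e inverse_eq_divide)
    have 2: "phi q (1 / b) = - phi q b - 1"
      by (rule phi_inverse) (use q nz th in auto)
    have 3: "D C = - phi q c * F C"
      using Dphi[of C] Fnz by (simp add: e)
    have "N (- B) = - D (- B) * F C + D C * F (- B) + k * F (- B) * F C"
      by (simp add: N_def F0 \<beta>_def)
    thus ?thesis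
      unfolding 1 2 3 by (simp add: k_def algebra_simps)
  qed
  moreover have "T (- B) \<noteq> 0"
    unfolding T_def F3 using Fnz by (simp add: \<beta>_def)
  ultimately have "N A = 0"
    using N_eq[of A "- B"] by simp
  moreover have "D A = - phi q a * F A" "D (A + \<beta>) = - phi q (a * b * c) * F (A + \<beta>)"
    using Dphi[of A] Dphi[of "A + \<beta>"] Fnz by (simp_all add: exp_add e \<beta>_def mult.assoc)
  ultimately have "(phi q a + phi q b + phi q c - phi q (a * b * c) + 1) * (F A * F (A + \<beta>)) =
                     r * (F (A + B) * F (A + C))"
    by (simp add: N_def k_def algebra_simps)
  hence "phi q a + phi q b + phi q c - phi q (a * b * c) + 1 =
      r * (F (A + B) * F (A + C)) / (F A * F (A + \<beta>))"
    using Fnz by (simp add: field_simps)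
  also have "\<dots> = (qpoch_inf q q)\<^sup>2 * F (A + B) * F \<beta> * F (A + C) / (F A * F B * F C * F (A + \<beta>))"
    by (simp add: r_def mult_ac)
  finally show ?thesis
    by (simp add: F_def \<beta>_def exp_add e mult.assoc)
qed

section \<open>The value at zero of an odd Dirichlet L-function\<close>

text \<open>The \<open>k\<close>-th difference of \<open>z\<close> to the power \<open>- s\<close> gains a factor of order \<open>1 / z\<^sup>k\<close>. Hence every
  Abel summation against partial sums that are recentred to mean zero, and so stay periodic,
  continues the series by one unit to the left; at \<open>s = 0\<close> only the first boundary term survives.\<close>

primrec powr_diff :: "nat \<Rightarrow> complex \<Rightarrow> complex \<Rightarrow> complex" where
  "powr_diff 0 s z = z powr (- s)"
| "powr_diff (Suc k) s z = powr_diff k s z - powr_diff k s (z + 1)"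

lemma powr_diff_DERIV:
  assumes "Re z > 0"
  shows "(powr_diff k s has_field_derivative - s * powr_diff k (s + 1) z) (at z)"
  using assms
proof (induction k arbitrary: z)
  case 0
  have "z \<notin> \<real>\<^sub>\<le>\<^sub>0"
    using 0 by (auto simp: complex_nonpos_Reals_iff)
  hence "((\<lambda>z. z powr (- s)) has_field_derivative - s * z powr (- s - 1)) (at z)"
    by (rule has_field_derivative_powr)
  moreover have "powr_diff 0 s = (\<lambda>z. z powr (- s))"
    by auto
  moreover have "- s - 1 = - (s + 1)"
    by simp
  ultimately show ?case
    by (simp only: powr_diff.simps(1))
next
  case (Suc k)
  have "((\<lambda>z. powr_diff k s (z + 1)) has_field_derivative - s * powr_diff k (s + 1) (z + 1)) (at z)"
    using Suc.IH[of "z + 1"] Suc.prems by (simp add: DERIV_shift)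
  with Suc.IH[of z] Suc.prems
  have "((\<lambda>z. powr_diff k s z - powr_diff k s (z + 1)) has_field_derivative
      - s * powr_diff k (s + 1) z - - s * powr_diff k (s + 1) (z + 1)) (at z)"
    by (intro DERIV_diff) auto
  thus ?case by (simp add: algebra_simps)
qed

text \<open>The mean value bound over a unit step trades one difference for a derivative, which is
  again a difference, at exponent s + 1 and with factor s. Hence the induction runs over all s; the
  condition on \<open>Re s + real k\<close> keeps the bounding power from growing along the
  step.\<close>

lemma norm_powr_diff_le:
  assumes "x > 0" "Re s + real k \<ge> 0"
  shows "norm (powr_diff k s (of_real x)) \<le> (\<Prod>i<k. norm (s + of_nat i)) * x powr (- (Re s + real k))"
  using assms
proof (induction k arbitrary: s x)
  case 0
  thus ?case by (simp add: norm_powr_real_powr)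
next
  case (Suc k)
  let ?S = "closed_segment (of_real x) (of_real (x + 1)) :: complex set"
  define B where "B = norm s * ((\<Prod>i<k. norm (s + 1 + of_nat i)) * x powr (- (Re (s + 1) + real k)))"
  have "norm (powr_diff k s (of_real x) - powr_diff k s (of_real (x + 1))) \<le>
          B * norm (of_real x - of_real (x + 1) :: complex)"
  proof (rule field_differentiable_bound[of ?S])
    fix z assume "z \<in> ?S"
    then obtain y where y: "z = of_real y" "x \<le> y"
      unfolding closed_segment_of_real by (auto simp: closed_segment_eq_real_ivl)
    show "(powr_diff k s has_field_derivative - s * powr_diff k (s + 1) z) (at z within ?S)"
      by (rule has_field_derivative_at_within, rule powr_diff_DERIV) (use y Suc.prems in auto)
    have "norm (powr_diff k (s + 1) (of_real y)) \<le>
        (\<Prod>i<k. norm (s + 1 + of_nat i)) * y powr (- (Re (s + 1) + real k))"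
      by (rule Suc.IH) (use y Suc.prems in auto)
    also have "y powr (- (Re (s + 1) + real k)) \<le> x powr (- (Re (s + 1) + real k))"
      by (rule powr_mono2') (use y Suc.prems in auto)
    finally show "norm (- s * powr_diff k (s + 1) z) \<le> B"
      unfolding B_def y by (simp add: norm_mult mult_left_mono prod_nonneg)
  qed auto
  also have "norm (of_real x - of_real (x + 1) :: complex) = 1"
    by simp
  also have "B = (\<Prod>i<Suc k. norm (s + of_nat i)) * x powr (- (Re s + real (Suc k)))"
    unfolding B_def by (subst prod.lessThan_Suc_shift) (simp add: add_ac)
  finally show ?case by simp
qed

lemma powr_diff_holomorphic: "Re z > 0 \<Longrightarrow> (\<lambda>s. powr_diff k s z) holomorphic_on A"
proof (induction k arbitrary: z)
  case 0
  thus ?case by (auto intro!: holomorphic_intros)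
next
  case (Suc k)
  thus ?case
    using Suc by (auto intro!: holomorphic_intros)
qed

lemma powr_diff_zero: "Re z > 0 \<Longrightarrow> powr_diff k 0 z = (if k = 0 then 1 else 0)"
  by (induction k arbitrary: z) (auto simp: powr_def)

definition mean_zero_periodic :: "nat \<Rightarrow> (nat \<Rightarrow> complex) \<Rightarrow> bool" where
  "mean_zero_periodic p a \<longleftrightarrow> p > 0 \<and> (\<forall>n. a (n + p) = a n) \<and> (\<Sum>n<p. a n) = 0"

text \<open>The Cesaro sum of the series of a when a is periodic with mean zero; it turns out to be
  the value at s = 0 of the continued Dirichlet series.\<close>

definition partial_sum_mean :: "nat \<Rightarrow> (nat \<Rightarrow> complex) \<Rightarrow> complex" where
  "partial_sum_mean p a = (\<Sum>n<p. \<Sum>i\<le>n. a i) / of_nat p"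

definition centred_sum :: "nat \<Rightarrow> (nat \<Rightarrow> complex) \<Rightarrow> nat \<Rightarrow> complex" where
  "centred_sum p a n = (\<Sum>i\<le>n. a i) - partial_sum_mean p a"

lemma mean_zero_periodic_centred_sum:
  assumes "mean_zero_periodic p a"
  shows "mean_zero_periodic p (centred_sum p a)"
proof -
  from assms have p: "p > 0" and per: "\<And>n. a (n + p) = a n" and z: "(\<Sum>n<p. a n) = 0"
    by (auto simp: mean_zero_periodic_def)
  have "(\<Sum>i\<le>n + p. a i) = (\<Sum>i\<le>n. a i)" for n
  proof (induction n)
    case 0
    have "(\<Sum>i\<le>p. a i) = (\<Sum>i<p. a i) + a p"
      by (simp flip: lessThan_Suc_atMost)
    thus ?case using z per[of 0] by simp
  next
    case (Suc n)
    thus ?case using per[of "Suc n"] by simp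
  qed
  thus ?thesis
    using p by (auto simp: mean_zero_periodic_def centred_sum_def partial_sum_mean_def sum_subtractf)
qed

lemma mean_zero_periodic_bounded:
  assumes "mean_zero_periodic p a"
  shows "norm (a n) \<le> (\<Sum>i<p. norm (a i))"
proof -
  from assms have p: "p > 0" and per: "\<And>n. a (n + p) = a n"
    by (auto simp: mean_zero_periodic_def)
  have "a (m + k * p) = a m" for m k
    by (induction k) (use per[of "m + _ * p"] in \<open>auto simp: add_ac\<close>)
  from this[of "n mod p" "n div p"] have "a n = a (n mod p)"
    by simp
  thus ?thesis
    using p member_le_sum[of "n mod p" "{..<p}" "\<lambda>i. norm (a i)"] by simp
qed

definition diff_series :: "(nat \<Rightarrow> complex) \<Rightarrow> nat \<Rightarrow> complex \<Rightarrow> complex" where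
  "diff_series a k s = (\<Sum>n. a n * powr_diff k s (of_nat (Suc n)))"

text \<open>Here \<epsilon> is half the distance of z from the line Re s + k = 1. On the closed ball
  the decay exponent thus stays at least 1 + \<epsilon>, which gives a summable majorant independent
  of s.\<close>

lemma diff_series_term_bound:
  assumes "mean_zero_periodic p a" "s \<in> cball z \<epsilon>" "\<epsilon> = (Re z + real k - 1) / 2" "\<epsilon> > 0"
  shows "norm (a n * powr_diff k s (of_nat (Suc n))) \<le>
     (\<Sum>i<p. norm (a i)) * ((\<Prod>i<k. norm z + \<epsilon> + real i) * real (Suc n) powr (- (1 + \<epsilon>)))"
proof -
  have s: "norm (z - s) \<le> \<epsilon>"
    using assms(2) by (simp add: dist_norm)
  hence "Re z - Re s \<le> \<epsilon>"
    using complex_Re_le_cmod[of "z - s"] by simp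
  hence re: "Re s + real k \<ge> 1 + \<epsilon>"
    using assms(3) by (simp add: field_simps)
  have ns: "norm (s + of_nat i) \<le> norm z + \<epsilon> + real i" for i
  proof -
    have "s + of_nat i = z - (z - s) + of_nat i" by simp
    also have "norm \<dots> \<le> norm z + norm (z - s) + norm (of_nat i :: complex)"
      by (intro order.trans[OF norm_triangle_ineq] add_mono norm_triangle_ineq4 order.refl)
    finally show ?thesis using s by simp
  qed
  have "norm (powr_diff k s (of_real (real (Suc n)))) \<le>
          (\<Prod>i<k. norm (s + of_nat i)) * real (Suc n) powr (- (Re s + real k))"
    by (rule norm_powr_diff_le) (use re assms(4) in auto)
  also have "\<dots> \<le> (\<Prod>i<k. norm z + \<epsilon> + real i) * real (Suc n) powr (- (1 + \<epsilon>))"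
    using re ns assms(4)
    by (intro mult_mono prod_mono powr_mono) (auto intro!: prod_nonneg add_nonneg_nonneg)
  finally show ?thesis
    unfolding norm_mult using mean_zero_periodic_bounded[OF assms(1), of n]
    by (intro mult_mono) (auto intro!: sum_nonneg)
qed

lemma summable_diff_series_bound:
  assumes "\<epsilon> > 0"
  shows "summable (\<lambda>n. C * (D * real (Suc n) powr (- (1 + \<epsilon>))))"
proof -
  have "summable (\<lambda>n. real n powr (- (1 + \<epsilon>)))"
    using assms by (subst summable_real_powr_iff) auto
  thus ?thesis
    by (subst (asm) summable_Suc_iff[symmetric]) (intro summable_mult)
qed

lemma summable_diff_series:
  assumes "mean_zero_periodic p a" "Re s + real k > 1"
  shows "summable (\<lambda>n. a n * powr_diff k s (of_nat (Suc n)))"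
proof (rule summable_comparison_test')
  define \<epsilon> where "\<epsilon> = (Re s + real k - 1) / 2"
  have e: "\<epsilon> > 0" using assms(2) by (simp add: \<epsilon>_def)
  show "summable (\<lambda>n. (\<Sum>i<p. norm (a i)) * ((\<Prod>i<k. norm s + \<epsilon> + real i) * real (Suc n) powr (- (1 + \<epsilon>))))"
    using e by (rule summable_diff_series_bound)
  show "norm (a n * powr_diff k s (of_nat (Suc n))) \<le>
     (\<Sum>i<p. norm (a i)) * ((\<Prod>i<k. norm s + \<epsilon> + real i) * real (Suc n) powr (- (1 + \<epsilon>)))"
     if "n \<ge> 0" for n
    by (rule diff_series_term_bound[OF assms(1) _ \<epsilon>_def e]) (use e in auto)
qed

lemma open_right_halfplane: "open {s. Re s + real k > 1}"
  by (intro open_Collect_less continuous_intros)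

lemma diff_series_holomorphic:
  assumes "mean_zero_periodic p a"
  shows "diff_series a k holomorphic_on {s. Re s + real k > 1}"
proof (rule holomorphic_uniform_sequence[OF open_right_halfplane])
  show "(\<lambda>s. \<Sum>n<N. a n * powr_diff k s (of_nat (Suc n))) holomorphic_on {s. Re s + real k > 1}" for N
    by (intro holomorphic_intros powr_diff_holomorphic) auto
next
  fix z assume "z \<in> {s. Re s + real k > 1}"
  define \<epsilon> where "\<epsilon> = (Re z + real k - 1) / 2"
  have e: "\<epsilon> > 0"
    using \<open>z \<in> _\<close> by (simp add: \<epsilon>_def)
  have "cball z \<epsilon> \<subseteq> {s. Re s + real k > 1}"
  proof
    fix s assume "s \<in> cball z \<epsilon>"
    hence "Re z - Re s \<le> \<epsilon>"
      using complex_Re_le_cmod[of "z - s"] by (simp add: dist_norm)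
    thus "s \<in> {s. Re s + real k > 1}"
      using e by (simp add: \<epsilon>_def field_simps)
  qed
  moreover have "uniform_limit (cball z \<epsilon>) (\<lambda>N s. \<Sum>n<N. a n * powr_diff k s (of_nat (Suc n)))
      (diff_series a k) sequentially"
    unfolding diff_series_def
    by (rule Weierstrass_m_test[OF diff_series_term_bound[OF assms _ \<epsilon>_def e]
          summable_diff_series_bound[OF e]])
  ultimately show "\<exists>d>0. cball z d \<subseteq> {s. Re s + real k > 1} \<and>
      uniform_limit (cball z d) (\<lambda>N s. \<Sum>n<N. a n * powr_diff k s (of_nat (Suc n)))
      (diff_series a k) sequentially"
    using e by blast
qed

text \<open>The constant m is free: the differences of \<phi> telescope, so its removal from the
  partial sums is paid for by \<open>m * \<phi> 0\<close> and the last boundary term.\<close>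

lemma abel_summation:
  fixes a \<phi> :: "nat \<Rightarrow> complex"
  shows "(\<Sum>n<N. a n * \<phi> n) =
           m * \<phi> 0 + (\<Sum>n<N. ((\<Sum>i\<le>n. a i) - m) * (\<phi> n - \<phi> (Suc n))) +
           ((\<Sum>i<N. a i) - m) * \<phi> N"
  by (induction N) (simp_all add: algebra_simps flip: lessThan_Suc_atMost)

lemma diff_series_abel:
  assumes "mean_zero_periodic p a" "Re s + real k > 1"
  shows "diff_series a k s =
    partial_sum_mean p a * powr_diff k s 1 + diff_series (centred_sum p a) (Suc k) s"
proof (rule LIMSEQ_unique)
  let ?m = "partial_sum_mean p a"
  let ?\<phi> = "\<lambda>n. powr_diff k s (of_nat (Suc n))"
  note b = mean_zero_periodic_centred_sum[OF assms(1)]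
  \<comment> \<open>Alternating signs form a mean-zero periodic sequence of absolute value 1, so the
    decay of \<phi> follows from the summability already proved.\<close>
  have \<phi>: "?\<phi> \<longlonglongrightarrow> 0"
  proof -
    have "mean_zero_periodic 2 (\<lambda>n. (- 1) ^ n)"
      by (simp add: mean_zero_periodic_def numeral_2_eq_2)
    from summable_LIMSEQ_zero[OF summable_diff_series[OF this assms(2)]]
    have "(\<lambda>n. norm ((- 1) ^ n * ?\<phi> n)) \<longlonglongrightarrow> 0"
      by (rule tendsto_norm_zero)
    thus ?thesis
      by (simp add: norm_mult norm_power tendsto_norm_zero_iff)
  qed
  have bdd: "norm ((\<Sum>i<N. a i) - ?m) \<le> norm ?m + (\<Sum>i<p. norm (centred_sum p a i))" for N
  proof (cases N)
    case 0
    thus ?thesis by (simp add: sum_nonneg)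
  next
    case (Suc n)
    thus ?thesis
      using mean_zero_periodic_bounded[OF b, of n]
      by (intro add_increasing norm_ge_zero) (simp add: lessThan_Suc_atMost centred_sum_def)
  qed
  have "(\<lambda>N. ((\<Sum>i<N. a i) - ?m) * ?\<phi> N) \<longlonglongrightarrow> 0"
    by (rule Lim_null_comparison[OF always_eventually, where g = "\<lambda>N. (norm ?m + (\<Sum>i<p. norm (centred_sum p a i))) * norm (?\<phi> N)"])
       (use bdd \<phi> in \<open>auto simp: norm_mult intro!: mult_right_mono tendsto_mult_right_zero tendsto_norm_zero\<close>)
  moreover have "(\<lambda>N. ?m * powr_diff k s 1 +
      (\<Sum>n<N. centred_sum p a n * powr_diff (Suc k) s (of_nat (Suc n)))) \<longlonglongrightarrow>
      ?m * powr_diff k s 1 + diff_series (centred_sum p a) (Suc k) s"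
    unfolding diff_series_def
    by (intro tendsto_intros summable_LIMSEQ summable_diff_series[OF b]) (use assms(2) in auto)
  ultimately have "(\<lambda>N. ?m * powr_diff k s 1 +
      (\<Sum>n<N. centred_sum p a n * powr_diff (Suc k) s (of_nat (Suc n))) +
      ((\<Sum>i<N. a i) - ?m) * ?\<phi> N) \<longlonglongrightarrow>
      ?m * powr_diff k s 1 + diff_series (centred_sum p a) (Suc k) s + 0"
    by (rule tendsto_add[rotated])
  also have "(\<lambda>N. ?m * powr_diff k s 1 +
      (\<Sum>n<N. centred_sum p a n * powr_diff (Suc k) s (of_nat (Suc n))) +
      ((\<Sum>i<N. a i) - ?m) * ?\<phi> N) = (\<lambda>N. \<Sum>n<N. a n * ?\<phi> n)"
  proof
    fix N
    have "(\<Sum>n<N. a n * ?\<phi> n) =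
           ?m * ?\<phi> 0 + (\<Sum>n<N. ((\<Sum>i\<le>n. a i) - ?m) * (?\<phi> n - ?\<phi> (Suc n))) +
           ((\<Sum>i<N. a i) - ?m) * ?\<phi> N"
      by (rule abel_summation)
    moreover have "(\<Sum>n<N. ((\<Sum>i\<le>n. a i) - ?m) * (?\<phi> n - ?\<phi> (Suc n))) =
        (\<Sum>n<N. centred_sum p a n * powr_diff (Suc k) s (of_nat (Suc n)))"
      by (simp add: centred_sum_def add_ac)
    ultimately show "?m * powr_diff k s 1 +
      (\<Sum>n<N. centred_sum p a n * powr_diff (Suc k) s (of_nat (Suc n))) +
      ((\<Sum>i<N. a i) - ?m) * ?\<phi> N = (\<Sum>n<N. a n * ?\<phi> n)"
      by simp
  qed
  finally show "(\<lambda>N. \<Sum>n<N. a n * ?\<phi> n) \<longlonglongrightarrow>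
      ?m * powr_diff k s 1 + diff_series (centred_sum p a) (Suc k) s"
    by simp
  show "(\<lambda>N. \<Sum>n<N. a n * ?\<phi> n) \<longlonglongrightarrow> diff_series a k s"
    unfolding diff_series_def by (rule summable_LIMSEQ[OF summable_diff_series[OF assms]])
qed

text \<open>The result of j Abel steps on a series that starts with k-th differences. Each step
  moves the half-plane \<open>Re s + real (k + j) > 1\<close> one unit to the left.\<close>

primrec continued_series :: "nat \<Rightarrow> nat \<Rightarrow> nat \<Rightarrow> (nat \<Rightarrow> complex) \<Rightarrow> complex \<Rightarrow> complex" where
  "continued_series p k 0 a s = diff_series a k s"
| "continued_series p k (Suc j) a s =
     partial_sum_mean p a * powr_diff k s 1 + continued_series p (Suc k) j (centred_sum p a) s"

lemma continued_series_Suc: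
  assumes "mean_zero_periodic p a" "Re s + real (k + j) > 1"
  shows "continued_series p k (Suc j) a s = continued_series p k j a s"
  using assms
proof (induction j arbitrary: k a)
  case 0
  thus ?case using diff_series_abel[of p a s k] by simp
next
  case (Suc j)
  have "continued_series p (Suc k) (Suc j) (centred_sum p a) s =
        continued_series p (Suc k) j (centred_sum p a) s"
    by (rule Suc.IH) (use Suc.prems mean_zero_periodic_centred_sum in auto)
  thus ?case by simp
qed

lemma continued_series_eq:
  assumes "mean_zero_periodic p a" "Re s + real j > 1" "j \<le> i"
  shows "continued_series p 0 i a s = continued_series p 0 j a s"
  using assms(3)
proof (induction rule: dec_induct)
  case (step n)
  have "continued_series p 0 (Suc n) a s = continued_series p 0 n a s"
    by (rule continued_series_Suc) (use assms step in auto)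
  with step show ?case by simp
qed auto

lemma continued_series_holomorphic:
  assumes "mean_zero_periodic p a"
  shows "continued_series p k j a holomorphic_on {s. Re s + real (k + j) > 1}"
  using assms
proof (induction j arbitrary: k a)
  case 0
  have "continued_series p k 0 a = diff_series a k" by auto
  thus ?case using diff_series_holomorphic[OF 0, of k] by simp
next
  case (Suc j)
  have "continued_series p (Suc k) j (centred_sum p a) holomorphic_on {s. Re s + real (Suc k + j) > 1}"
    by (rule Suc.IH) (use Suc.prems mean_zero_periodic_centred_sum in auto)
  moreover have "continued_series p k (Suc j) a = (\<lambda>s. partial_sum_mean p a * powr_diff k s 1 +
      continued_series p (Suc k) j (centred_sum p a) s)"
    by auto
  ultimately show ?case
    by (auto intro!: holomorphic_intros powr_diff_holomorphic)
qed

lemma continued_series_zero: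
  "continued_series p (Suc k) j a 0 = 0"
proof (induction j arbitrary: k a)
  case 0
  have "powr_diff (Suc k) 0 (of_nat (Suc n)) = 0" for n
    by (subst powr_diff_zero) auto
  thus ?case by (simp add: diff_series_def del: of_nat_Suc powr_diff.simps)
next
  case (Suc j)
  have "powr_diff (Suc k) 0 1 = 0"
    by (subst powr_diff_zero) auto
  with Suc show ?case by (simp del: powr_diff.simps)
qed

theorem periodic_dirichlet_series_continuation:
  assumes "mean_zero_periodic p a"
  obtains f where "f holomorphic_on UNIV"
    "\<And>s. Re s > 1 \<Longrightarrow> f s = (\<Sum>n. a n / of_nat (Suc n) powr s)"
    "f 0 = partial_sum_mean p a"
proof
  \<comment> \<open>The number of steps grows with -Re s. Further steps change nothing where fewer
    already converge, so near every point f agrees with a single \<open>continued_series\<close> and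
    is holomorphic.\<close>
  define f where "f = (\<lambda>s. continued_series p 0 (Suc (nat \<lceil>1 - Re s\<rceil>)) a s)"
  have f: "f s = continued_series p 0 j a s" if "Re s + real j > 1" for s j
  proof -
    have *: "Re s + real (Suc (nat \<lceil>1 - Re s\<rceil>)) > 1"
      by linarith
    show ?thesis
    proof (cases "Suc (nat \<lceil>1 - Re s\<rceil>) \<le> j")
      case True
      from continued_series_eq[OF assms * this] show ?thesis
        unfolding f_def by (rule sym)
    next
      case False
      hence "j \<le> Suc (nat \<lceil>1 - Re s\<rceil>)" by linarith
      from continued_series_eq[OF assms that this] show ?thesis
        unfolding f_def .
    qed
  qed
  have "f field_differentiable at s" for s
  proof -
    define j where "j = Suc (nat \<lceil>1 - Re s\<rceil>)"
    have s: "s \<in> {s. Re s + real j > 1}"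
      unfolding j_def mem_Collect_eq by linarith
    have "continued_series p 0 j a holomorphic_on {s. Re s + real j > 1}"
      using continued_series_holomorphic[OF assms, of 0 j] by simp
    hence "f holomorphic_on {s. Re s + real j > 1}"
      by (rule holomorphic_transform) (use f in auto)
    thus ?thesis
      by (rule holomorphic_on_imp_differentiable_at[OF _ open_right_halfplane s])
  qed
  thus "f holomorphic_on UNIV"
    by (simp add: holomorphic_on_def)
  show "f s = (\<Sum>n. a n / of_nat (Suc n) powr s)" if "Re s > 1" for s
    using f[of s 0] that by (simp add: diff_series_def powr_minus field_simps del: of_nat_Suc)
  \<comment> \<open>Two steps are used because after one step s = 0 still lies on the boundary of
    the half-plane.\<close>
  show "f 0 = partial_sum_mean p a"
    using f[of 0 2] by (simp add: numeral_2_eq_2 continued_series_zero powr_def del: continued_series.simps(1))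
qed

lemma dirichlet_L_zero:
  assumes "mean_zero_periodic p (\<lambda>n. chi (int (Suc n)))"
  shows "dirichlet_L chi 0 = partial_sum_mean p (\<lambda>n. chi (int (Suc n)))"
proof -
  obtain f where f: "f holomorphic_on UNIV"
    "\<And>s. Re s > 1 \<Longrightarrow> f s = (\<Sum>n. chi (int (Suc n)) / of_nat (Suc n) powr s)"
    "f 0 = partial_sum_mean p (\<lambda>n. chi (int (Suc n)))"
    using periodic_dirichlet_series_continuation[OF assms] by blast
  have "dirichlet_L chi = f"
    unfolding dirichlet_L_def
  proof (rule the_equality)
    fix g assume g: "g holomorphic_on UNIV \<and>
      (\<forall>s. Re s > 1 \<longrightarrow> g s = (\<Sum>n. chi (int (Suc n)) / of_nat (Suc n) powr s))"
    show "g = f"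
    proof
      fix z
      show "g z = f z"
      proof (rule analytic_continuation_open[where s = "{s. Re s > 1}" and s' = UNIV and f = g and g = f])
        show "open {s. Re s > 1}"
          using open_right_halfplane[of 0] by simp
        show "{s. Re s > 1} \<noteq> {}"
          by (auto intro: exI[of _ 2])
      qed (use f g in auto)
    qed
  qed (use f in auto)
  with f show ?thesis by simp
qed

section \<open>Odd characters modulo a prime\<close>

lemma odd_dirichlet_charactersD:
  assumes "chi \<in> odd_dirichlet_characters p"
  shows "chi (a * b) = chi a * chi b" "chi (a + int p) = chi a" "chi a = 0 \<longleftrightarrow> \<not> coprime a (int p)"
    "chi 1 = 1" "chi (- a) = - chi a" "chi (-1) = -1"
proof -
  have mult: "chi (a * b) = chi a * chi b" and per: "chi (a + int p) = chi a"
    and nz: "chi a \<noteq> 0 \<longleftrightarrow> coprime a (int p)" and minus: "chi (-1) = -1" for a b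
    using assms by (auto simp: odd_dirichlet_characters_def dirichlet_character_def)
  show "chi (a * b) = chi a * chi b" "chi (a + int p) = chi a" "chi (-1) = -1"
    by (rule mult per minus)+
  show "chi a = 0 \<longleftrightarrow> \<not> coprime a (int p)"
    using nz[of a] by blast
  have "chi 1 * chi 1 = chi 1"
    using mult[of 1 1] by simp
  moreover have "chi 1 \<noteq> 0"
    using nz[of 1] by simp
  ultimately show "chi 1 = 1" by simp
  show "chi (- a) = - chi a"
    using mult[of "-1" a] minus by simp
qed

lemma odd_dirichlet_characters_cong:
  assumes "chi \<in> odd_dirichlet_characters p" "[a = b] (mod int p)"
  shows "chi a = chi b"
proof -
  have per: "chi (c + int p) = chi c" for c
    using odd_dirichlet_charactersD(2)[OF assms(1)] .
  have shift: "chi (c + int p * k) = chi c" for c k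
  proof (induction k rule: int_induct[of _ 0])
    case (step1 i) thus ?case using per[of "c + int p * i"] by (simp add: algebra_simps)
  next
    case (step2 i) thus ?case using per[of "c + int p * (i - 1)"] by (simp add: algebra_simps)
  qed auto
  have "b = a + int p * ((b - a) div int p)"
    using assms(2) by (simp add: cong_iff_dvd_diff dvd_diff_commute)
  thus ?thesis
    using shift[of a "(b - a) div int p"] by simp
qed

lemma odd_dirichlet_characters_power:
  assumes "chi \<in> odd_dirichlet_characters p"
  shows "chi (a ^ n) = chi a ^ n"
  by (induction n) (simp_all add: odd_dirichlet_charactersD[OF assms])

definition odd_indicator :: "nat \<Rightarrow> int \<Rightarrow> complex" where
  "odd_indicator p m = of_bool [m = 1] (mod int p) - of_bool [m = -1] (mod int p)"

text \<open>An odd character is determined by its value w at a primitive root, where w^h = -1, so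
  this is orthogonality in disguise. If h divides i, every summand is (-1)^(i/h). Otherwise some
  h-th root of unity z has z^i \<noteq> 1; multiplication by z permutes the roots of -1 and scales
  the sum by z^i.\<close>

lemma sum_powers_roots_minus_one:
  assumes "h > 0"
  shows "(\<Sum>w | w ^ h = (-1 :: complex). w ^ i) =
    (if i mod (2 * h) = 0 then of_nat h else if i mod (2 * h) = h then - of_nat h else 0)"
proof (cases "h dvd i")
  case True
  then obtain k where k: "i = h * k" by blast
  have card: "card {w :: complex. w ^ h = -1} = h"
    using assms by (intro card_nth_roots) auto
  have "(\<Sum>w | w ^ h = (-1 :: complex). w ^ i) = (\<Sum>w | w ^ h = (-1 :: complex). (-1) ^ k)"
    by (intro sum.cong) (auto simp: k power_mult)
  also have "\<dots> = of_nat h * (-1) ^ k"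
    by (simp add: card)
  finally have *: "(\<Sum>w | w ^ h = (-1 :: complex). w ^ i) = of_nat h * (-1) ^ k" .
  show ?thesis
  proof (cases "even k")
    case True
    hence "i mod (2 * h) = 0" by (auto simp: k elim!: evenE)
    thus ?thesis using * True by simp
  next
    case False
    then obtain l where "k = 2 * l + 1" by (rule oddE)
    hence "i = h + (2 * h) * l" by (simp add: k algebra_simps)
    hence "i mod (2 * h) = h mod (2 * h)" by simp
    thus ?thesis using * False assms by simp
  qed
next
  case False
  define d where "d = i mod h"
  have d: "0 < d" "d < h"
    using False assms by (auto simp: d_def mod_greater_zero_iff_not_dvd)
  \<comment> \<open>If every h-th root of unity had z^i = 1, all h of them would be d-th roots of
    unity, and d < h.\<close>
  have "\<exists>z :: complex. z ^ h = 1 \<and> z ^ i \<noteq> 1"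
  proof (rule ccontr)
    assume "\<nexists>z :: complex. z ^ h = 1 \<and> z ^ i \<noteq> 1"
    hence all: "z ^ i = 1" if "z ^ h = 1" for z :: complex
      using that by blast
    have "z ^ d = 1" if z: "z ^ h = 1" for z :: complex
    proof -
      have "z ^ i = z ^ (h * (i div h) + d)"
        unfolding d_def by simp
      also have "\<dots> = (z ^ h) ^ (i div h) * z ^ d"
        by (simp only: power_add power_mult)
      finally show ?thesis using z all[OF z] by simp
    qed
    hence "{z :: complex. z ^ h = 1} \<subseteq> {z. z ^ d = 1}"
      by blast
    hence "card {z :: complex. z ^ h = 1} \<le> card {z :: complex. z ^ d = 1}"
      using d by (intro card_mono finite_roots_unity) auto
    moreover have "card {z :: complex. z ^ h = 1} = h" "card {z :: complex. z ^ d = 1} = d"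
      using d by (auto intro!: card_nth_roots)
    ultimately show False using d by simp
  qed
  then obtain z :: complex where z: "z ^ h = 1" "z ^ i \<noteq> 1" by blast
  have znz: "z \<noteq> 0" using z(1) assms by (auto simp: power_0_left)
  have "(\<Sum>w | w ^ h = (-1 :: complex). w ^ i) = (\<Sum>w | w ^ h = (-1 :: complex). (z * w) ^ i)"
    by (rule sum.reindex_bij_witness[of _ "\<lambda>w. z * w" "\<lambda>w. w / z"])
       (use z znz in \<open>auto simp: power_mult_distrib power_divide\<close>)
  also have "\<dots> = z ^ i * (\<Sum>w | w ^ h = (-1 :: complex). w ^ i)"
    by (simp add: power_mult_distrib sum_distrib_left)
  finally have "(\<Sum>w | w ^ h = (-1 :: complex). w ^ i) = 0"
    using z(2) by simp
  moreover have "i mod (2 * h) \<noteq> 0" "i mod (2 * h) \<noteq> h"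
  proof -
    have "i mod (2 * h) mod h = d"
      by (simp add: d_def mod_mod_cancel)
    thus "i mod (2 * h) \<noteq> 0" "i mod (2 * h) \<noteq> h"
      using d by (metis mod_0 less_irrefl, metis mod_self less_irrefl)
  qed
  ultimately show ?thesis by simp
qed

locale odd_prime =
  fixes p :: nat
  assumes prime: "prime p" and p_gt_2: "p > 2"
begin

definition h :: nat where "h = (p - 1) div 2"

lemma p_eq: "p = 2 * h + 1"
  using prime p_gt_2 prime_odd_nat[of p] by (auto simp: h_def elim!: oddE)

lemma of_nat_p: "of_nat p = (2 * of_nat h + 1 :: 'a :: semiring_1)"
  using arg_cong[OF p_eq, of "of_nat :: nat \<Rightarrow> 'a"] by (simp only: of_nat_add of_nat_mult of_nat_numeral of_nat_1)

lemma h_pos: "h > 0"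
  using p_eq p_gt_2 by simp

lemma coprime_iff: "coprime m (int p) \<longleftrightarrow> \<not> int p dvd m"
  using prime_imp_coprime[of "int p" m] prime p_gt_2
  by (metis coprime_commute coprime_absorb_left not_prime_unit prime_nat_int_transfer)

text \<open>The discrete logarithm to a primitive root g; through it a character is determined by
  the single number chi(g).\<close>

lemma ex_odd_index:
  obtains g :: int and ind :: "int \<Rightarrow> nat" where
    "coprime g (int p)"
    "\<And>m. coprime m (int p) \<Longrightarrow> [g ^ ind m = m] (mod int p)"
    "\<And>m. coprime m (int p) \<Longrightarrow> ind m < 2 * h"
    "\<And>i j. [g ^ i = g ^ j] (mod int p) \<longleftrightarrow> [i = j] (mod 2 * h)"
proof -
  obtain g where g: "residue_primroot p g"
    using prime_primitive_root_exists[of p] prime p_gt_2 by (auto)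
  have cop: "coprime p g" and ord: "ord p g = 2 * h"
    using g prime p_eq by (auto simp: residue_primroot_def totient_prime)
  have "totient p = 2 * h"
    using prime p_eq by (simp add: totient_prime)
  hence bij: "bij_betw (\<lambda>i. g ^ i mod p) {..<2 * h} (totatives p)"
    using residue_primroot_is_generator[OF _ g] p_gt_2 by simp
  have ex: "\<exists>i<2 * h. [int g ^ i = m] (mod int p)" if "coprime m (int p)" for m
  proof -
    have "nat (m mod int p) \<in> totatives p"
    proof -
      have "m mod int p \<noteq> 0" "m mod int p < int p" "m mod int p \<ge> 0"
        using that p_gt_2 by (auto simp: coprime_iff dvd_eq_mod_eq_0)
      thus ?thesis
        using prime by (auto simp: totatives_prime)
    qed
    then obtain i where i: "i < 2 * h" "nat (m mod int p) = g ^ i mod p"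
      using bij by (auto simp: bij_betw_def)
    have "m mod int p = int (nat (m mod int p))"
      using p_gt_2 by simp
    also have "\<dots> = int g ^ i mod int p"
      unfolding i(2) by (simp add: zmod_int)
    finally show ?thesis
      using i(1) by (auto simp: cong_def)
  qed
  define ind where "ind = (\<lambda>m. SOME i. i < 2 * h \<and> [int g ^ i = m] (mod int p))"
  have ind: "ind m < 2 * h \<and> [int g ^ ind m = m] (mod int p)" if "coprime m (int p)" for m
    unfolding ind_def by (rule someI_ex) (use ex[OF that] in blast)
  show thesis
  proof (rule that)
    show "coprime (int g) (int p)"
      using cop by (simp add: coprime_commute)
    show "[int g ^ i = int g ^ j] (mod int p) \<longleftrightarrow> [i = j] (mod 2 * h)" for i j
    proof -
      have "[int g ^ i = int g ^ j] (mod int p) \<longleftrightarrow> [g ^ i = g ^ j] (mod p)"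
        by (metis cong_int_iff of_nat_power)
      also have "\<dots> \<longleftrightarrow> [i = j] (mod 2 * h)"
        using order_divides_expdiff[of p g i j] cop ord by (simp add: coprime_commute)
      finally show ?thesis .
    qed
  qed (use ind in auto)
qed

text \<open>Evaluation at a primitive root g identifies the odd characters with the solutions of w^h
  = -1: as g^h is -1 modulo p, oddness says chi(g)^h = -1. The character sum becomes a power sum
  over these roots.\<close>

theorem odd_character_orthogonality:
  "finite (odd_dirichlet_characters p)"
  "(\<Sum>chi\<in>odd_dirichlet_characters p. chi m) = of_nat h * odd_indicator p m"
proof -
  obtain g :: int and ind :: "int \<Rightarrow> nat" where g: "coprime g (int p)"
    and ind: "\<And>m. coprime m (int p) \<Longrightarrow> [g ^ ind m = m] (mod int p)"
    and ind_less: "\<And>m. coprime m (int p) \<Longrightarrow> ind m < 2 * h"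
    and cong_iff: "\<And>i j. [g ^ i = g ^ j] (mod int p) \<longleftrightarrow> [i = j] (mod 2 * h)"
    using ex_odd_index by blast
  have ind_eq: "[ind m = i] (mod 2 * h)" if "coprime m (int p)" "[g ^ i = m] (mod int p)" for m i
    using ind[OF that(1)] that(2) cong_iff by (meson cong_sym cong_trans)
  have gh: "[g ^ h = -1] (mod int p)"
  proof -
    have "[g ^ (2 * h) = 1] (mod int p)"
      using cong_iff[of "2 * h" 0] by (simp add: cong_def)
    hence "int p dvd (g ^ h - 1) * (g ^ h - (-1))"
      by (simp add: cong_iff_dvd_diff algebra_simps power_mult power2_eq_square mult_2 power_add)
    hence "[g ^ h = 1] (mod int p) \<or> [g ^ h = -1] (mod int p)"
      using prime by (simp add: prime_dvd_mult_iff cong_iff_dvd_diff)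
    moreover have "\<not> [g ^ h = g ^ 0] (mod int p)"
      unfolding cong_iff using h_pos by (simp add: cong_def)
    ultimately show ?thesis by simp
  qed
  define X where "X = (\<lambda>(w :: complex) m. if coprime m (int p) then w ^ ind m else 0)"
  let ?W = "{w :: complex. w ^ h = -1}"
  have pow_cong: "w ^ i = w ^ j" if "w \<in> ?W" "[i = j] (mod 2 * h)" for w i j
  proof -
    have "w ^ (2 * h) = 1"
      using that(1) by (simp add: mult_2 power_add)
    hence "w ^ k = w ^ (k mod (2 * h))" for k
      by (metis mult_div_mod_eq power_add power_mult power_one mult_1)
    thus ?thesis
      using that(2) by (metis cong_def)
  qed
  have Xodd: "X w \<in> odd_dirichlet_characters p" if w: "w \<in> ?W" for w
    unfolding odd_dirichlet_characters_def dirichlet_character_def mem_Collect_eq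
  proof (intro conjI allI)
    have wnz: "w \<noteq> 0"
      using w h_pos by (auto simp: power_0_left)
    show "X w (a * b) = X w a * X w b" for a b
    proof (cases "coprime a (int p) \<and> coprime b (int p)")
      case True
      hence "[ind (a * b) = ind a + ind b] (mod 2 * h)"
        by (intro ind_eq) (auto simp: power_add intro!: cong_mult ind)
      from pow_cong[OF w this] True show ?thesis
        by (simp add: X_def power_add)
    qed (auto simp: X_def)
    show "X w (a + int p) = X w a" for a
    proof (cases "coprime a (int p)")
      case True
      hence c: "coprime (a + int p) (int p)"
        by (simp add: coprime_iff)
      have "[g ^ ind a = a + int p] (mod int p)"
        using ind[OF True] by (simp add: cong_def)
      from pow_cong[OF w ind_eq[OF c this]] True c show ?thesis
        by (simp add: X_def)
    qed (simp add: X_def coprime_iff)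
    show "X w a \<noteq> 0 \<longleftrightarrow> coprime a (int p)" for a
      using wnz by (simp add: X_def)
    have "[ind (-1) = h] (mod 2 * h)"
      by (rule ind_eq) (use gh in auto)
    from pow_cong[OF w this] show "X w (- 1) = - 1"
      using w by (simp add: X_def)
  qed
  have bij: "bij_betw X ?W (odd_dirichlet_characters p)"
  proof (rule bij_betwI)
    show "X \<in> ?W \<rightarrow> odd_dirichlet_characters p"
      using Xodd by blast
    show "(\<lambda>chi. chi g) \<in> odd_dirichlet_characters p \<rightarrow> ?W"
    proof safe
      fix chi assume chi: "chi \<in> odd_dirichlet_characters p"
      have "chi g ^ h = chi (g ^ h)"
        by (simp add: odd_dirichlet_characters_power[OF chi])
      also have "\<dots> = -1"
        using odd_dirichlet_characters_cong[OF chi gh] odd_dirichlet_charactersD(6)[OF chi] by simp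
      finally show "chi g ^ h = -1" .
    qed
    show "X w g = w" if "w \<in> ?W" for w
      using pow_cong[OF that ind_eq[OF g, of 1]] g by (simp add: X_def)
    show "X (chi g) = chi" if chi: "chi \<in> odd_dirichlet_characters p" for chi
    proof
      fix m show "X (chi g) m = chi m"
      proof (cases "coprime m (int p)")
        case True
        thus ?thesis
          using odd_dirichlet_characters_cong[OF chi ind[OF True]]
          by (simp add: X_def odd_dirichlet_characters_power[OF chi])
      next
        case False
        thus ?thesis
          using odd_dirichlet_charactersD(3)[OF chi, of m] by (simp add: X_def)
      qed
    qed
  qed
  have "finite ?W"
    using h_pos by (intro finite_nth_roots)
  thus "finite (odd_dirichlet_characters p)"
    using bij_betw_finite[OF bij] by simp
  have "(\<Sum>chi\<in>odd_dirichlet_characters p. chi m) = (\<Sum>w\<in>?W. X w m)"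
    using sum.reindex_bij_betw[OF bij, of "\<lambda>chi. chi m"] by simp
  also have "\<dots> = of_nat h * odd_indicator p m"
  proof (cases "coprime m (int p)")
    case True
    have 0: "[m = 1] (mod int p) \<longleftrightarrow> ind m = 0"
    proof -
      have "[m = 1] (mod int p) \<longleftrightarrow> [g ^ ind m = g ^ 0] (mod int p)"
        using ind[OF True] by (metis cong_sym cong_trans power_0)
      thus ?thesis
        unfolding cong_iff using ind_less[OF True] by (simp add: cong_def)
    qed
    have 1: "[m = -1] (mod int p) \<longleftrightarrow> ind m = h"
    proof -
      have "[m = -1] (mod int p) \<longleftrightarrow> [g ^ ind m = g ^ h] (mod int p)"
        using ind[OF True] gh by (meson cong_sym cong_trans)
      thus ?thesis
        unfolding cong_iff using ind_less[OF True] h_pos by (simp add: cong_def)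
    qed
    have "(\<Sum>w\<in>?W. X w m) = (\<Sum>w\<in>?W. w ^ ind m)"
      using True by (simp add: X_def)
    also have "\<dots> = of_nat h * odd_indicator p m"
      unfolding sum_powers_roots_minus_one[OF h_pos] odd_indicator_def 0 1
      using h_pos ind_less[OF True] by simp
    finally show ?thesis .
  next
    case False
    hence "\<not> [m = 1] (mod int p)" "\<not> [m = -1] (mod int p)"
      using cong_imp_coprime[of 1 m "int p"] cong_imp_coprime[of "-1" m "int p"]
      by (auto simp: cong_sym_eq)
    thus ?thesis
      using False by (simp add: X_def odd_indicator_def)
  qed
  finally show "(\<Sum>chi\<in>odd_dirichlet_characters p. chi m) = of_nat h * odd_indicator p m" .
qed

end

section \<open>Eisenstein series of weight one as sums of Lambert series\<close>

text \<open>Minus the first periodic Bernoulli function at m / p, made odd by the value 0 at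
  multiples of p.\<close>

definition sawtooth :: "nat \<Rightarrow> int \<Rightarrow> complex" where
  "sawtooth p m = (if int p dvd m then 0 else 1 / 2 - of_int (m mod int p) / of_nat p)"

lemma sawtooth_cong: "[a = b] (mod int p) \<Longrightarrow> sawtooth p a = sawtooth p b"
  by (simp add: sawtooth_def cong_def dvd_eq_mod_eq_0)

lemma sum_sum_atMost:
  fixes a :: "nat \<Rightarrow> complex"
  shows "(\<Sum>n<N. \<Sum>i\<le>n. a i) = (\<Sum>i<N. (of_nat N - of_nat i) * a i)"
  by (induction N) (simp_all add: left_diff_distrib distrib_right sum_subtractf sum.distrib flip: lessThan_Suc_atMost)

lemma summable_lambert:
  fixes q :: complex
  assumes "norm q < 1" "\<And>n. norm (c n) \<le> C"
  shows "summable (\<lambda>n. c n * (q ^ Suc n / (1 - q ^ Suc n)))"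
proof (rule summable_comparison_test')
  show "summable (\<lambda>n. C * (norm q ^ n / (1 - norm q)))"
    using assms(1) by (intro summable_mult summable_divide summable_geometric) auto
  show "norm (c n * (q ^ Suc n / (1 - q ^ Suc n))) \<le> C * (norm q ^ n / (1 - norm q))" if "n \<ge> 0" for n
  proof -
    have le: "norm q ^ Suc n \<le> norm q" "norm q ^ Suc n \<le> norm q ^ n"
      using assms(1) power_decreasing[of 1 "Suc n" "norm q"] power_decreasing[of n "Suc n" "norm q"]
      by auto
    have "1 - norm (q ^ Suc n) \<le> norm (1 - q ^ Suc n)"
      using norm_triangle_ineq2[of 1 "q ^ Suc n"] by simp
    hence "1 - norm q \<le> norm (1 - q ^ Suc n)"
      using le by (simp add: norm_power norm_mult)
    hence "norm (q ^ Suc n / (1 - q ^ Suc n)) \<le> norm q ^ n / (1 - norm q)"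
      unfolding norm_divide norm_power using assms(1) le by (intro frac_le) auto
    thus ?thesis
      unfolding norm_mult by (intro mult_mono assms(2)) (auto intro: order.trans[OF norm_ge_zero assms(2)])
  qed
qed

text \<open>The weight-one Eisenstein series of a residue class. Summed over the residues m against
  an odd character chi it gives \<open>dirichlet_L chi 0 * eisenstein_char chi \<tau>\<close> when q
  is \<open>nome \<tau>\<close>, which explains the constant term.\<close>

definition lambert_res :: "nat \<Rightarrow> complex \<Rightarrow> int \<Rightarrow> complex" where
  "lambert_res p q m = sawtooth p m +
     (\<Sum>n. (of_bool [int (Suc n) = m] (mod int p) - of_bool [int (Suc n) = - m] (mod int p)) *
           (q ^ Suc n / (1 - q ^ Suc n)))"

lemma lambert_res_cong:
  assumes "[a = b] (mod int p)"
  shows "lambert_res p q a = lambert_res p q b"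
proof -
  have "[n = a] (mod int p) \<longleftrightarrow> [n = b] (mod int p)" "[n = - a] (mod int p) \<longleftrightarrow> [n = - b] (mod int p)" for n
    using assms by (meson cong_sym cong_trans cong_minus_minus_iff)+
  thus ?thesis
    by (simp add: lambert_res_def sawtooth_cong[OF assms])
qed

lemma suminf_residue_class:
  fixes q :: complex
  assumes q: "norm q < 1" and m: "0 < m" "m < p"
  shows "(\<Sum>n. of_bool [int (Suc n) = int m] (mod int p) * (q ^ Suc n / (1 - q ^ Suc n))) =
           lambert_sum (q ^ p) (q ^ m)"
proof -
  \<comment> \<open>Terms at index n carry the exponent \<open>Suc n\<close>, hence m - 1.\<close>
  let ?g = "\<lambda>k. m - 1 + p * k"
  have sm: "strict_mono ?g"
    by (intro strict_monoI add_strict_left_mono mult_strict_left_mono) (use m in auto)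
  have "(\<lambda>k. of_bool [int (Suc (?g k)) = int m] (mod int p) * (q ^ Suc (?g k) / (1 - q ^ Suc (?g k))))
          sums (\<Sum>n. of_bool [int (Suc n) = int m] (mod int p) * (q ^ Suc n / (1 - q ^ Suc n)))"
  proof (subst sums_mono_reindex[OF sm])
    show "of_bool [int (Suc n) = int m] (mod int p) * (q ^ Suc n / (1 - q ^ Suc n)) = 0"
      if "n \<notin> range ?g" for n
    proof -
      have "\<not> [int (Suc n) = int m] (mod int p)"
      proof
        assume "[int (Suc n) = int m] (mod int p)"
        hence "Suc n mod p = m"
          using m by (simp only: cong_int_iff) (simp add: cong_def)
        hence "n = ?g (Suc n div p)"
          using m mult_div_mod_eq[of p "Suc n"] by simp
        with that show False by blast
      qed
      thus ?thesis by simp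
    qed
  qed (rule summable_sums[OF summable_lambert[OF q, of _ 1]], auto)
  moreover have "of_bool [int (Suc (?g k)) = int m] (mod int p) * (q ^ Suc (?g k) / (1 - q ^ Suc (?g k))) =
       q ^ m * (q ^ p) ^ k / (1 - q ^ m * (q ^ p) ^ k)" for k
  proof -
    have "Suc (?g k) = m + p * k"
      using m by simp
    moreover have "[int (m + p * k) = int m] (mod int p)"
      by (simp only: cong_int_iff) (simp add: cong_def)
    ultimately show ?thesis
      by (simp only: power_add power_mult) simp
  qed
  ultimately show ?thesis
    by (simp add: lambert_sum_def sums_iff)
qed

text \<open>The class of -m is represented by p - m, and q^(p-m) = q^p / q^m is the second argument
  inside \<open>phi\<close> at nome q^p.\<close>

lemma lambert_res_eq_phi:
  fixes q :: complex
  assumes q: "norm q < 1" "q \<noteq> 0" and m: "0 < m" "m < p"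
  shows "lambert_res p q (int m) = phi (q ^ p) (q ^ m) + 1 / 2 - of_nat m / of_nat p"
proof -
  have "[- int m = int (p - m)] (mod int p)"
    using m by (simp add: cong_iff_dvd_diff of_nat_diff)
  hence "[int (Suc n) = - int m] (mod int p) \<longleftrightarrow> [int (Suc n) = int (p - m)] (mod int p)" for n
    by (meson cong_sym cong_trans)
  hence eq: "(\<Sum>n. of_bool [int (Suc n) = - int m] (mod int p) * (q ^ Suc n / (1 - q ^ Suc n))) =
      lambert_sum (q ^ p) (q ^ (p - m))"
    using suminf_residue_class[OF q(1), of "p - m" p] m by simp
  have "(\<Sum>n. (of_bool [int (Suc n) = int m] (mod int p) - of_bool [int (Suc n) = - int m] (mod int p)) *
           (q ^ Suc n / (1 - q ^ Suc n))) =
     (\<Sum>n. of_bool [int (Suc n) = int m] (mod int p) * (q ^ Suc n / (1 - q ^ Suc n))) -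
     (\<Sum>n. of_bool [int (Suc n) = - int m] (mod int p) * (q ^ Suc n / (1 - q ^ Suc n)))"
    unfolding left_diff_distrib
    by (intro suminf_diff[symmetric] summable_lambert[OF q(1), of _ 1]) auto
  also have "\<dots> = phi (q ^ p) (q ^ m)"
    unfolding eq suminf_residue_class[OF q(1) m] phi_def using m q
    by (simp add: power_diff)
  finally have *: "(\<Sum>n. (of_bool [int (Suc n) = int m] (mod int p) - of_bool [int (Suc n) = - int m] (mod int p)) *
           (q ^ Suc n / (1 - q ^ Suc n))) = phi (q ^ p) (q ^ m)" .
  have "\<not> int p dvd int m"
    using m by (auto dest: dvd_imp_le)
  moreover have "int m mod int p = int m"
    using m by simp
  ultimately show ?thesis
    unfolding lambert_res_def * by (simp add: sawtooth_def)
qed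

text \<open>A zero would give q^m = q^(p n) for some integer n. Passing to absolute values yields m
  = p n, because ln |q| is nonzero.\<close>

lemma theta_power_nonzero:
  fixes q :: complex
  assumes q: "norm q < 1" "q \<noteq> 0" and p: "p > 0" and m: "\<not> p dvd m"
  shows "theta (q ^ p) (q ^ m) \<noteq> 0"
proof
  assume "theta (q ^ p) (q ^ m) = 0"
  then obtain n where "q ^ m = (q ^ p) powi n"
    using theta_eq_0_imp[of "q ^ p" "q ^ m"] q p norm_power_less_one[of q p] by auto
  hence "q powi (int m) = q powi (int p * n)"
    by (simp add: power_int_mult)
  hence "norm q powi (int m) = norm q powi (int p * n)"
    by (metis norm_power_int)
  moreover have "norm q powi k = exp (of_int k * ln (norm q))" for k
    using exp_power_int[of "ln (norm q)" k] q by simp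
  ultimately have "of_int (int m) * ln (norm q) = of_int (int p * n) * ln (norm q)"
    by (simp only: exp_inj_iff)
  hence "int m = int p * n"
    using q by (simp del: of_int_mult of_int_of_nat_eq)
  hence "int p dvd int m" by simp
  with m show False by simp
qed

text \<open>Raising m by p adds 1 to \<open>phi\<close> and subtracts 1 through -m / p, so the
  formula holds for unreduced m as well. It is needed there because products such as u r and their
  sums are not reduced.\<close>

lemma lambert_res_eq_phi':
  fixes q :: complex
  assumes q: "norm q < 1" "q \<noteq> 0" and p: "p > 0" and m: "\<not> p dvd m"
  shows "lambert_res p q (int m) = phi (q ^ p) (q ^ m) + 1 / 2 - of_nat m / of_nat p"
  using m
proof (induction m rule: less_induct)
  case (less m)
  show ?case
  proof (cases "m < p")
    case True
    moreover have "m > 0" using less.prems by (cases m) auto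
    ultimately show ?thesis using lambert_res_eq_phi[OF q] by blast
  next
    case False
    define n where "n = m - p"
    have m: "m = n + p"
      using False by (simp add: n_def)
    hence n: "\<not> p dvd n"
      using less.prems by simp
    have "lambert_res p q (int m) = lambert_res p q (int n)"
      by (rule lambert_res_cong) (simp add: m cong_def)
    also have "\<dots> = phi (q ^ p) (q ^ n) + 1 / 2 - of_nat n / of_nat p"
      by (rule less.IH) (use n m p in auto)
    also have "phi (q ^ p) (q ^ m) = phi (q ^ p) (q ^ n) + 1"
      unfolding m power_add
      by (rule phi_shift) (use q p norm_power_less_one[of q p] theta_power_nonzero[OF q p n] in auto)
    hence "phi (q ^ p) (q ^ n) + 1 / 2 - of_nat n / of_nat p = phi (q ^ p) (q ^ m) + 1 / 2 - of_nat m / of_nat p"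
      using p by (simp add: m field_simps)
    finally show ?thesis .
  qed
qed

section \<open>Character sums modulo p and the value of L at zero\<close>

context odd_prime
begin

lemma bij_betw_mult_residues:
  assumes "coprime r (int p)"
  shows "bij_betw (\<lambda>d. d * r mod int p) {0..<int p} {0..<int p}"
proof -
  have "inj_on (\<lambda>d. d * r mod int p) {0..<int p}"
  proof (rule inj_onI)
    fix x y assume xy: "x \<in> {0..<int p}" "y \<in> {0..<int p}" "x * r mod int p = y * r mod int p"
    hence "[x * r = y * r] (mod int p)"
      by (simp add: cong_def)
    hence "[x = y] (mod int p)"
      using assms by (simp add: cong_mult_rcancel)
    thus "x = y" using xy by (simp add: cong_def)
  qed
  moreover have "(\<lambda>d. d * r mod int p) ` {0..<int p} \<subseteq> {0..<int p}"
    using p_gt_2 by auto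
  ultimately show ?thesis
    unfolding bij_betw_def by (intro conjI endo_inj_surj) auto
qed

lemma sum_odd_character_mult:
  assumes chi: "chi \<in> odd_dirichlet_characters p" and r: "coprime r (int p)"
    and f: "\<And>a b. [a = b] (mod int p) \<Longrightarrow> f a = f b"
  shows "chi r * (\<Sum>d\<in>{0..<int p}. chi d * f (d * r)) = (\<Sum>d\<in>{0..<int p}. chi d * f d)"
proof -
  have "(\<Sum>d\<in>{0..<int p}. chi d * f d) = (\<Sum>d\<in>{0..<int p}. chi (d * r mod int p) * f (d * r mod int p))"
    by (rule sum.reindex_bij_betw[OF bij_betw_mult_residues[OF r], symmetric])
  also have "\<dots> = (\<Sum>d\<in>{0..<int p}. chi (d * r) * f (d * r))"
    by (intro sum.cong refl arg_cong2[of _ _ _ _ "(*)"] odd_dirichlet_characters_cong[OF chi] f) auto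
  finally show ?thesis
    by (simp add: odd_dirichlet_charactersD(1)[OF chi] sum_distrib_left mult_ac)
qed

lemma sum_odd_character:
  assumes chi: "chi \<in> odd_dirichlet_characters p"
  shows "(\<Sum>d\<in>{0..<int p}. chi d) = 0"
proof -
  have "chi (-1) * (\<Sum>d\<in>{0..<int p}. chi d * 1) = (\<Sum>d\<in>{0..<int p}. chi d * 1)"
    by (rule sum_odd_character_mult[OF chi]) auto
  thus ?thesis
    by (simp add: odd_dirichlet_charactersD(6)[OF chi] equal_neg_zero)
qed

lemma odd_character_zero: "chi \<in> odd_dirichlet_characters p \<Longrightarrow> chi 0 = 0"
  using odd_dirichlet_charactersD(5)[of chi p 0] by simp

lemma sum_residues_Suc:
  fixes f :: "int \<Rightarrow> complex"
  assumes "f (int p) = f 0"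
  shows "(\<Sum>d\<in>{0..<int p}. f d) = (\<Sum>n<p. f (int (Suc n)))"
proof -
  have "(\<Sum>d\<in>{0..<int p}. f d) = (\<Sum>n<p. f (int n))"
    by (rule sum.reindex_bij_witness[of _ int nat]) auto
  also have "\<dots> = (\<Sum>n<p. f (int (Suc n)))"
  proof -
    have "(\<Sum>n<p. f (int n)) + f 0 = (\<Sum>n<p. f (int (Suc n))) + f 0"
      using sum.lessThan_Suc_shift[of "\<lambda>n. f (int n)" p] assms by (simp add: add.commute)
    thus ?thesis by (simp only: add_right_cancel)
  qed
  finally show ?thesis .
qed

lemma odd_character_series:
  assumes chi: "chi \<in> odd_dirichlet_characters p"
  shows "mean_zero_periodic p (\<lambda>n. chi (int (Suc n)))"
  unfolding mean_zero_periodic_def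
proof (intro conjI allI)
  show "chi (int (Suc (n + p))) = chi (int (Suc n))" for n
    using odd_dirichlet_charactersD(2)[OF chi, of "int (Suc n)"] by (simp add: add_ac)
  have "chi (int p) = chi 0"
    using odd_dirichlet_charactersD(2)[OF chi, of 0] by simp
  thus "(\<Sum>n<p. chi (int (Suc n))) = 0"
    using sum_residues_Suc[of chi] sum_odd_character[OF chi] by simp
qed (use p_gt_2 in auto)

text \<open>In the mean of the partial sums chi(d) has weight (p + 1 - d) / p, for d from 1 to p.
  For d < p this is \<open>sawtooth p d\<close> plus the constant 1/2 + 1/p, which drops out because
  the values of chi sum to zero; the term d = p vanishes with chi.\<close>

lemma dirichlet_L_zero_sawtooth:
  assumes chi: "chi \<in> odd_dirichlet_characters p"
  shows "dirichlet_L chi 0 = (\<Sum>d\<in>{0..<int p}. chi d * sawtooth p d)"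
proof -
  have z: "chi (int p) = 0"
    using odd_dirichlet_charactersD(2)[OF chi, of 0] odd_character_zero[OF chi] by simp
  have p0: "of_nat p \<noteq> (0 :: complex)"
    using p_gt_2 by simp
  note mz = odd_character_series[OF chi]
  have "dirichlet_L chi 0 = (\<Sum>i<p. (of_nat p - of_nat i) * chi (int (Suc i))) / of_nat p"
    using dirichlet_L_zero[OF mz] by (simp add: partial_sum_mean_def sum_sum_atMost)
  also have "\<dots> = (\<Sum>i<p. (of_nat p - of_nat i) * chi (int (Suc i)) / of_nat p)"
    by (rule sum_divide_distrib)
  also have "\<dots> = (\<Sum>i<p. chi (int (Suc i)) * sawtooth p (int (Suc i)) + (1 / 2 + 1 / of_nat p) * chi (int (Suc i)))"
  proof (rule sum.cong[OF refl])
    fix i assume "i \<in> {..<p}"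
    then consider "Suc i = p" | "Suc i < p" by fastforce
    thus "(of_nat p - of_nat i) * chi (int (Suc i)) / of_nat p =
       chi (int (Suc i)) * sawtooth p (int (Suc i)) + (1 / 2 + 1 / of_nat p) * chi (int (Suc i))"
    proof cases
      case 1
      show ?thesis unfolding 1 z by simp
    next
      case 2
      have "\<not> int p dvd int (Suc i)"
        using 2 by (simp only: int_dvd_int_iff) (auto dest: dvd_imp_le)
      hence "sawtooth p (int (Suc i)) = 1 / 2 - (of_nat i + 1) / of_nat p"
        using 2 by (simp add: sawtooth_def)
      thus ?thesis
        using p0 by (simp only:) (simp add: field_simps)
    qed
  qed
  also have "\<dots> = (\<Sum>i<p. chi (int (Suc i)) * sawtooth p (int (Suc i)))"
    using mz by (simp add: sum.distrib mean_zero_periodic_def flip: sum_distrib_left)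
  also have "\<dots> = (\<Sum>d\<in>{0..<int p}. chi d * sawtooth p d)"
    using sum_residues_Suc[of "\<lambda>d. chi d * sawtooth p d"] z odd_character_zero[OF chi] by simp
  finally show ?thesis .
qed

text \<open>When p divides none of r, s, t, r + s + t, the left side is 1 minus the number of
  carries in adding d r, d s and d t modulo p, a number among 0, 1, 2. The relation asks for no
  carry at d = 1, two at d = p - 1 and exactly one elsewhere.\<close>

definition sawtooth_relation :: "nat \<Rightarrow> nat \<Rightarrow> nat \<Rightarrow> bool" where
  "sawtooth_relation r s t \<longleftrightarrow> (\<forall>d\<in>{1..<int p}.
     sawtooth p (d * int r) + sawtooth p (d * int s) + sawtooth p (d * int t)
       - sawtooth p (d * int (r + s + t)) = of_bool (d = 1) - of_bool (d = int p - 1))"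

lemma sawtooth_relation_coprime:
  assumes rel: "sawtooth_relation r s t" and d: "coprime d (int p)"
  shows "sawtooth p (d * int r) + sawtooth p (d * int s) + sawtooth p (d * int t)
       - sawtooth p (d * int (r + s + t)) = odd_indicator p d"
proof -
  define e where "e = d mod int p"
  have e: "e \<in> {1..<int p}"
  proof -
    have "e \<noteq> 0" "e \<ge> 0" "e < int p"
      using d p_gt_2 by (auto simp: e_def coprime_iff dvd_eq_mod_eq_0)
    thus ?thesis by simp
  qed
  have c: "[d = e] (mod int p)"
    by (simp add: e_def cong_def)
  have sw: "sawtooth p (d * m) = sawtooth p (e * m)" for m
    by (rule sawtooth_cong) (rule cong_scalar_right[OF c])
  have iff: "[d = 1] (mod int p) \<longleftrightarrow> e = 1" "[d = -1] (mod int p) \<longleftrightarrow> e = int p - 1"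
    using p_gt_2 by (simp_all add: e_def cong_def zmod_minus1)
  have "sawtooth p (e * int r) + sawtooth p (e * int s) + sawtooth p (e * int t)
       - sawtooth p (e * int (r + s + t)) = of_bool (e = 1) - of_bool (e = int p - 1)"
    using rel e unfolding sawtooth_relation_def by blast
  thus ?thesis
    unfolding sw odd_indicator_def iff .
qed

text \<open>Substituting d m for d shows that the sum of chi(d) sawtooth(d m) is L(0, chi) / chi(m).
  The relation then evaluates the combination of four such sums as chi(1) - chi(-1) = 2, which also
  yields L(0, chi) \<noteq> 0.\<close>

lemma two_div_dirichlet_L:
  assumes chi: "chi \<in> odd_dirichlet_characters p" and rel: "sawtooth_relation r s t"
    and cop: "coprime r p" "coprime s p" "coprime t p" "coprime (r + s + t) p"
  shows "2 / dirichlet_L chi 0 = 1 / chi (int r) + 1 / chi (int s) + 1 / chi (int t) - 1 / chi (int (r + s + t))"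
proof -
  let ?D = "{0..<int p}"
  define T where "T = dirichlet_L chi 0"
  have T: "(\<Sum>d\<in>?D. chi d * sawtooth p (d * int m)) = T * (1 / chi (int m))" if "coprime m p" for m
  proof -
    have "chi (int m) * (\<Sum>d\<in>?D. chi d * sawtooth p (d * int m)) = T"
      unfolding T_def dirichlet_L_zero_sawtooth[OF chi]
      by (rule sum_odd_character_mult[OF chi]) (use that in \<open>auto intro: sawtooth_cong\<close>)
    moreover have "chi (int m) \<noteq> 0"
      using odd_dirichlet_charactersD(3)[OF chi, of "int m"] that by simp
    ultimately show ?thesis by (simp add: field_simps)
  qed
  have "T * (1 / chi (int r) + 1 / chi (int s) + 1 / chi (int t) - 1 / chi (int (r + s + t))) =
    (\<Sum>d\<in>?D. chi d * (sawtooth p (d * int r) + sawtooth p (d * int s) + sawtooth p (d * int t)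
       - sawtooth p (d * int (r + s + t))))"
    unfolding distrib_left right_diff_distrib sum.distrib sum_subtractf
      T[OF cop(1)] T[OF cop(2)] T[OF cop(3)] T[OF cop(4)] ..
  also have "\<dots> = (\<Sum>d\<in>?D. chi d * (of_bool (d = 1) - of_bool (d = int p - 1)))"
  proof (rule sum.cong[OF refl])
    fix d assume d: "d \<in> ?D"
    show "chi d * (sawtooth p (d * int r) + sawtooth p (d * int s) + sawtooth p (d * int t)
       - sawtooth p (d * int (r + s + t))) = chi d * (of_bool (d = 1) - of_bool (d = int p - 1))"
    proof (cases "d = 0")
      case True
      thus ?thesis by (simp add: odd_character_zero[OF chi])
    next
      case False
      hence "d \<in> {1..<int p}" using d by simp
      thus ?thesis using rel by (simp only: sawtooth_relation_def)
    qed
  qed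
  also have "\<dots> = chi 1 - chi (int p - 1)"
  proof -
    have "(\<Sum>d\<in>?D. chi d * of_bool (d = e)) = chi e" if "e \<in> ?D" for e
    proof -
      have "(\<Sum>d\<in>?D. chi d * of_bool (d = e)) = (\<Sum>d\<in>?D. if d = e then chi d else 0)"
        by (intro sum.cong) auto
      thus ?thesis using that by simp
    qed
    from this[of 1] this[of "int p - 1"] show ?thesis
      using p_gt_2 by (simp add: right_diff_distrib sum_subtractf)
  qed
  also have "chi (int p - 1) = -1"
    using odd_dirichlet_charactersD(2)[OF chi, of "-1"] odd_dirichlet_charactersD(6)[OF chi] by simp
  finally have *: "T * (1 / chi (int r) + 1 / chi (int s) + 1 / chi (int t) - 1 / chi (int (r + s + t))) = 2"
    using odd_dirichlet_charactersD(4)[OF chi] by simp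
  hence "T \<noteq> 0" by auto
  with * show ?thesis
    unfolding T_def[symmetric] by (simp add: field_simps)
qed

lemma odd_indicator_mult:
  assumes u: "[a * u = 1] (mod int p)" and r: "coprime r (int p)" and r': "[r * r' = 1] (mod int p)"
  shows "odd_indicator p (a * n * r') = of_bool [n = u * r] (mod int p) - of_bool [n = - (u * r)] (mod int p)"
proof -
  have cu: "coprime u (int p)"
    using u by (metis cong_imp_coprime cong_sym coprime_1_left coprime_mult_left_iff)
  have iff: "[a * n * r' = e] (mod int p) \<longleftrightarrow> [n = e * (u * r)] (mod int p)" for e
  proof -
    have 1: "[a * n * r' * (u * r) = n] (mod int p)"
    proof -
      have "[(a * u) * (r * r') * n = 1 * 1 * n] (mod int p)"
        by (intro cong_mult u r' cong_refl)
      thus ?thesis by (simp add: mult_ac)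
    qed
    have "[a * n * r' = e] (mod int p) \<longleftrightarrow> [a * n * r' * (u * r) = e * (u * r)] (mod int p)"
      using cu r by (simp add: cong_mult_rcancel)
    also have "\<dots> \<longleftrightarrow> [n = e * (u * r)] (mod int p)"
      using 1 by (meson cong_sym cong_trans)
    finally show ?thesis .
  qed
  show ?thesis
    unfolding odd_indicator_def iff[of 1] iff[of "-1"] by simp
qed

text \<open>With 2 / L(0, chi) expanded, the coefficient at n is a combination of chi(a n / m) for m
  in {r, s, t, r + s + t}. Orthogonality turns each into the condition that n is u m or -u m modulo
  p, which selects the Lambert series of the class u m.\<close>

lemma eisenstein_res_eq_lambert:
  fixes r s t u :: nat
  assumes \<tau>: "Im \<tau> > 0" and rel: "sawtooth_relation r s t"
    and cop: "coprime r p" "coprime s p" "coprime t p" "coprime (r + s + t) p"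
    and u: "[a * int u = 1] (mod int p)"
  shows "eisenstein_res a p \<tau> = lambert_res p (nome \<tau>) (int (u * r)) + lambert_res p (nome \<tau>) (int (u * s)) +
     lambert_res p (nome \<tau>) (int (u * t)) - lambert_res p (nome \<tau>) (int (u * (r + s + t)))"
proof -
  let ?O = "odd_dirichlet_characters p"
  define q where "q = nome \<tau>"
  have q: "norm q < 1"
    using \<tau> by (simp add: q_def nome_def)
  define l where "l = (\<lambda>n. q ^ Suc n / (1 - q ^ Suc n))"
  \<comment> \<open>Integer inverses modulo p replace 1 / chi(m) by a character value, to which
    orthogonality applies.\<close>
  have "\<exists>r'. [int m * r' = 1] (mod int p)" if "coprime m p" for m
    using that by (intro cong_solve_coprime_int) simp
  then obtain iv where iv: "\<And>m. coprime m p \<Longrightarrow> [int m * iv m = 1] (mod int p)"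
    by metis
  have chi_iv: "1 / chi (int m) = chi (iv m)" if "chi \<in> ?O" "coprime m p" for chi m
  proof -
    have "chi (int m) * chi (iv m) = 1"
      using odd_dirichlet_characters_cong[OF that(1) iv[OF that(2)]]
      by (simp add: odd_dirichlet_charactersD[OF that(1)])
    moreover from this have "chi (int m) \<noteq> 0" by auto
    ultimately show ?thesis by (simp add: field_simps)
  qed
  define X where "X = (\<lambda>chi :: int \<Rightarrow> complex. chi (iv r) + chi (iv s) + chi (iv t) - chi (iv (r + s + t)))"
  have orth: "(\<Sum>chi\<in>?O. chi m) = of_nat h * odd_indicator p m" for m
    by (rule odd_character_orthogonality)
  have fin: "finite ?O"
    by (rule odd_character_orthogonality)
  have hnz: "of_nat h \<noteq> (0 :: complex)"
    using h_pos by simp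
  have summ: "summable (\<lambda>n. chi (int (Suc n)) * l n)" if "chi \<in> ?O" for chi
    unfolding l_def
    by (rule summable_lambert[OF q mean_zero_periodic_bounded[OF odd_character_series[OF that]]])
  have E: "eisenstein_char chi \<tau> = 1 + (\<Sum>n. X chi * (chi (int (Suc n)) * l n))" if chi: "chi \<in> ?O" for chi
    unfolding suminf_mult[OF summ[OF chi]]
    unfolding eisenstein_char_def two_div_dirichlet_L[OF chi rel cop]
      chi_iv[OF chi cop(1)] chi_iv[OF chi cop(2)] chi_iv[OF chi cop(3)] chi_iv[OF chi cop(4)]
      X_def l_def q_def ..
  define I where "I = (\<lambda>m n. of_bool [int (Suc n) = int (u * m)] (mod int p) - of_bool [int (Suc n) = - int (u * m)] (mod int p) :: complex)"
  have term_eq: "(\<Sum>chi\<in>?O. chi a * (X chi * (chi (int (Suc n)) * l n))) =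
      of_nat h * ((I r n + I s n + I t n - I (r + s + t) n) * l n)" for n
  proof -
    have "(\<Sum>chi\<in>?O. chi a * (X chi * (chi (int (Suc n)) * l n))) =
      (\<Sum>chi\<in>?O. (chi (a * int (Suc n) * iv r) + chi (a * int (Suc n) * iv s) + chi (a * int (Suc n) * iv t)
          - chi (a * int (Suc n) * iv (r + s + t))) * l n)"
    proof (rule sum.cong[OF refl])
      fix chi assume chi: "chi \<in> ?O"
      show "chi a * (X chi * (chi (int (Suc n)) * l n)) =
        (chi (a * int (Suc n) * iv r) + chi (a * int (Suc n) * iv s) + chi (a * int (Suc n) * iv t)
          - chi (a * int (Suc n) * iv (r + s + t))) * l n"
        unfolding odd_dirichlet_charactersD(1)[OF chi] X_def by (simp add: algebra_simps)
    qed
    also have "\<dots> = of_nat h * (odd_indicator p (a * int (Suc n) * iv r) + odd_indicator p (a * int (Suc n) * iv s)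
        + odd_indicator p (a * int (Suc n) * iv t) - odd_indicator p (a * int (Suc n) * iv (r + s + t))) * l n"
      unfolding sum_distrib_right[symmetric] sum.distrib sum_subtractf orth by (simp only: algebra_simps)
    also have "\<dots> = of_nat h * ((I r n + I s n + I t n - I (r + s + t) n) * l n)"
    proof -
      have "odd_indicator p (a * int (Suc n) * iv m) = I m n" if "coprime m p" for m
        using odd_indicator_mult[OF u _ iv[OF that], of "int (Suc n)"] that by (simp add: I_def)
      from this[OF cop(1)] this[OF cop(2)] this[OF cop(3)] this[OF cop(4)] show ?thesis
        by (simp only: mult.assoc)
    qed
    finally show ?thesis .
  qed
  have sumI: "summable (\<lambda>n. I m n * l n)" for m
    unfolding l_def by (rule summable_lambert[OF q, of _ 1]) (auto simp: I_def)
  have indicator: "odd_indicator p a = odd_indicator p (int u)"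
  proof -
    have "odd_indicator p (a * 1 * 1) = of_bool [1 = int u * 1] (mod int p) - of_bool [1 = - (int u * 1)] (mod int p)"
      by (rule odd_indicator_mult[OF u]) auto
    moreover have "[1 = - int u] (mod int p) \<longleftrightarrow> [int u = - 1] (mod int p)"
      using cong_minus_minus_iff[of "-1" "int u" "int p"] by (simp add: cong_sym_eq)
    ultimately show ?thesis
      by (simp add: odd_indicator_def cong_sym_eq)
  qed
  have cu: "coprime (int u) (int p)"
    using u by (metis cong_imp_coprime cong_sym coprime_1_left coprime_mult_left_iff)
  have summ': "summable (\<lambda>n. chi a * (X chi * (chi (int (Suc n)) * l n)))" if "chi \<in> ?O" for chi
    by (intro summable_mult summ that)
  have "eisenstein_res a p \<tau> = (1 / of_nat h) * (\<Sum>chi\<in>?O. chi a * eisenstein_char chi \<tau>)"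
    using hnz by (simp add: eisenstein_res_def of_nat_p)
  also have "(\<Sum>chi\<in>?O. chi a * eisenstein_char chi \<tau>) =
      (\<Sum>chi\<in>?O. chi a + (\<Sum>n. chi a * (X chi * (chi (int (Suc n)) * l n))))"
  proof (rule sum.cong[OF refl])
    fix chi assume chi: "chi \<in> ?O"
    have "summable (\<lambda>n. X chi * (chi (int (Suc n)) * l n))"
      by (intro summable_mult summ chi)
    from suminf_mult[OF this, of "chi a"]
    show "chi a * eisenstein_char chi \<tau> = chi a + (\<Sum>n. chi a * (X chi * (chi (int (Suc n)) * l n)))"
      unfolding E[OF chi] by (simp add: distrib_left)
  qed
  also have "\<dots> = of_nat h * odd_indicator p a +
      (\<Sum>n. \<Sum>chi\<in>?O. chi a * (X chi * (chi (int (Suc n)) * l n)))"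
    using suminf_sum[where I = ?O and f = "\<lambda>chi n. chi a * (X chi * (chi (int (Suc n)) * l n))", OF summ']
    by (simp add: sum.distrib orth)
  also have "(\<Sum>n. \<Sum>chi\<in>?O. chi a * (X chi * (chi (int (Suc n)) * l n))) =
      of_nat h * (\<Sum>n. (I r n + I s n + I t n - I (r + s + t) n) * l n)"
    unfolding term_eq by (intro suminf_mult) (unfold distrib_right left_diff_distrib, intro summable_add summable_diff sumI)
  also have "(\<Sum>n. (I r n + I s n + I t n - I (r + s + t) n) * l n) =
      (\<Sum>n. I r n * l n) + (\<Sum>n. I s n * l n) + (\<Sum>n. I t n * l n) - (\<Sum>n. I (r + s + t) n * l n)"
    unfolding distrib_right left_diff_distrib
    by (simp only: suminf_add[symmetric] suminf_diff[symmetric] summable_add sumI)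
  \<comment> \<open>The constant terms 1 average to \<open>odd_indicator p a\<close>. The sawtooth
    relation at d = u splits it into the constant terms of the four residue series, so one relation
    serves both purposes.\<close>
  also have "odd_indicator p a = sawtooth p (int u * int r) + sawtooth p (int u * int s)
      + sawtooth p (int u * int t) - sawtooth p (int u * int (r + s + t))"
    unfolding indicator sawtooth_relation_coprime[OF rel cu] ..
  finally have "eisenstein_res a p \<tau> = (sawtooth p (int u * int r) + sawtooth p (int u * int s)
      + sawtooth p (int u * int t) - sawtooth p (int u * int (r + s + t))) +
      ((\<Sum>n. I r n * l n) + (\<Sum>n. I s n * l n) + (\<Sum>n. I t n * l n) - (\<Sum>n. I (r + s + t) n * l n))"
    using hnz by (simp add: distrib_left)
  thus ?thesis
    unfolding lambert_res_def I_def l_def q_def of_nat_mult by (simp only: algebra_simps)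
qed

end

section \<open>The product over the residue tuple\<close>

text \<open>The exponential factor makes the theta function antiperiodic and even under \<open>m \<mapsto> p - m\<close>;
  it is \<open>q\<close> to the power \<open>m (m - p) / (2 p)\<close>.\<close>

definition klein :: "nat \<Rightarrow> complex \<Rightarrow> nat \<Rightarrow> complex" where
  "klein p \<tau> m = exp (of_real pi * \<i> * \<tau> * (of_nat m * (of_nat m - of_nat p) / of_nat p)) *
     theta (nome \<tau> ^ p) (nome \<tau> ^ m)"

lemma norm_nome_less_one: "Im \<tau> > 0 \<Longrightarrow> norm (nome \<tau>) < 1"
  by (simp add: nome_def)

lemma nome_nonzero: "nome \<tau> \<noteq> 0"
  by (simp add: nome_def)

lemma nome_power: "nome \<tau> ^ m = exp (2 * of_real pi * \<i> * \<tau> * of_nat m)"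
  by (simp add: nome_def exp_of_nat_mult[symmetric] mult_ac)

lemma klein_nonzero:
  assumes "Im \<tau> > 0" "p > 0" "\<not> p dvd m"
  shows "klein p \<tau> m \<noteq> 0"
  using theta_power_nonzero[OF norm_nome_less_one[OF assms(1)] nome_nonzero assms(2,3)]
  by (simp add: klein_def)

lemma klein_minus_period:
  assumes "Im \<tau> > 0" "p > 0" "p \<le> m"
  shows "klein p \<tau> m = - klein p \<tau> (m - p)"
proof -
  define n where "n = m - p"
  have m: "m = n + p" using assms by (simp add: n_def)
  note q = norm_nome_less_one[OF assms(1)]
  have "theta (nome \<tau> ^ p) (nome \<tau> ^ m) = - theta (nome \<tau> ^ p) (nome \<tau> ^ n) / nome \<tau> ^ n"
    unfolding m power_add
    by (rule theta_shift) (use nome_nonzero norm_power_less_one[OF q assms(2)] in auto)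
  moreover have "exp (of_real pi * \<i> * \<tau> * (of_nat m * (of_nat m - of_nat p) / of_nat p)) =
      exp (of_real pi * \<i> * \<tau> * (of_nat n * (of_nat n - of_nat p) / of_nat p)) * nome \<tau> ^ n"
    unfolding nome_power exp_add[symmetric]
    by (rule arg_cong[of _ _ exp]) (use assms in \<open>simp add: m field_simps\<close>)
  ultimately show ?thesis
    using nome_nonzero by (simp add: klein_def flip: n_def)
qed

lemma klein_reflect:
  assumes "Im \<tau> > 0" "m < p"
  shows "klein p \<tau> (p - m) = klein p \<tau> m"
proof -
  have "theta (nome \<tau> ^ p) (nome \<tau> ^ (p - m)) = theta (nome \<tau> ^ p) (nome \<tau> ^ m)"
    using assms nome_nonzero by (simp add: theta_def power_diff mult.commute)
  moreover have "of_nat (p - m) * (of_nat (p - m) - of_nat p) / of_nat p =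
      (of_nat m * (of_nat m - of_nat p) / of_nat p :: complex)"
    using assms by (simp add: of_nat_diff field_simps)
  ultimately show ?thesis
    by (simp only: klein_def)
qed

text \<open>The exponential factors cancel because (r+s)^2 + (s+t)^2 + (r+t)^2 = r^2 + s^2 + t^2 +
  (r+s+t)^2 and the linear parts agree as well. The constants 1/2 - m/p add up to the 1 of the
  addition theorem.\<close>

lemma klein_addition:
  assumes \<tau>: "Im \<tau> > 0" and p: "p > 0"
    and dvd: "\<not> p dvd r" "\<not> p dvd s" "\<not> p dvd t" "\<not> p dvd s + t" "\<not> p dvd r + s + t"
  defines "q \<equiv> nome \<tau>"
  shows "lambert_res p q (int r) + lambert_res p q (int s) + lambert_res p q (int t) - lambert_res p q (int (r + s + t)) =
    (qpoch_inf (q ^ p) (q ^ p))\<^sup>2 * klein p \<tau> (r + s) * klein p \<tau> (s + t) * klein p \<tau> (r + t) /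
      (klein p \<tau> r * klein p \<tau> s * klein p \<tau> t * klein p \<tau> (r + s + t))"
proof -
  have q: "norm q < 1" "q \<noteq> 0"
    using norm_nome_less_one[OF \<tau>] nome_nonzero by (simp_all add: q_def)
  define e :: "nat \<Rightarrow> complex" where "e = (\<lambda>m. exp (of_real pi * \<i> * \<tau> * (of_nat m * (of_nat m - of_nat p) / of_nat p)))"
  have k: "klein p \<tau> m = e m * theta (q ^ p) (q ^ m)" for m
    by (simp add: klein_def e_def q_def)
  have e: "e (r + s) * e (s + t) * e (r + t) = e r * e s * e t * e (r + s + t)" "e m \<noteq> 0" for m
    unfolding e_def exp_add[symmetric]
    by (rule arg_cong[of _ _ exp]) (use p in \<open>simp_all add: field_simps\<close>)
  note eq = lambert_res_eq_phi'[OF q p]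
  have nz: "theta (q ^ p) (q ^ m) \<noteq> 0" if "\<not> p dvd m" for m
    by (rule theta_power_nonzero[OF q p that])
  have "lambert_res p q (int r) + lambert_res p q (int s) + lambert_res p q (int t) - lambert_res p q (int (r + s + t)) =
     phi (q ^ p) (q ^ r) + phi (q ^ p) (q ^ s) + phi (q ^ p) (q ^ t) - phi (q ^ p) (q ^ r * q ^ s * q ^ t) + 1"
    unfolding eq[OF dvd(1)] eq[OF dvd(2)] eq[OF dvd(3)] eq[OF dvd(5)] power_add[symmetric]
    using p by (simp add: field_simps)
  also have "\<dots> = (qpoch_inf (q ^ p) (q ^ p))\<^sup>2 * theta (q ^ p) (q ^ r * q ^ s) * theta (q ^ p) (q ^ s * q ^ t) * theta (q ^ p) (q ^ r * q ^ t) /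
      (theta (q ^ p) (q ^ r) * theta (q ^ p) (q ^ s) * theta (q ^ p) (q ^ t) * theta (q ^ p) (q ^ r * q ^ s * q ^ t))"
    by (rule theta_phi_addition)
       (use q p norm_power_less_one[OF q(1) p] dvd in \<open>auto simp flip: power_add intro!: nz\<close>)
  also have "\<dots> = (qpoch_inf (q ^ p) (q ^ p))\<^sup>2 * klein p \<tau> (r + s) * klein p \<tau> (s + t) * klein p \<tau> (r + t) /
      (klein p \<tau> r * klein p \<tau> s * klein p \<tau> t * klein p \<tau> (r + s + t))"
  proof -
    have "(qpoch_inf (q ^ p) (q ^ p))\<^sup>2 * klein p \<tau> (r + s) * klein p \<tau> (s + t) * klein p \<tau> (r + t) /
      (klein p \<tau> r * klein p \<tau> s * klein p \<tau> t * klein p \<tau> (r + s + t)) =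
      ((e (r + s) * e (s + t) * e (r + t)) * ((qpoch_inf (q ^ p) (q ^ p))\<^sup>2 * theta (q ^ p) (q ^ (r + s)) * theta (q ^ p) (q ^ (s + t)) * theta (q ^ p) (q ^ (r + t)))) /
      ((e r * e s * e t * e (r + s + t)) * (theta (q ^ p) (q ^ r) * theta (q ^ p) (q ^ s) * theta (q ^ p) (q ^ t) * theta (q ^ p) (q ^ (r + s + t))))"
      unfolding k by (simp only: mult_ac)
    also have "\<dots> = (qpoch_inf (q ^ p) (q ^ p))\<^sup>2 * theta (q ^ p) (q ^ (r + s)) * theta (q ^ p) (q ^ (s + t)) * theta (q ^ p) (q ^ (r + t)) /
      (theta (q ^ p) (q ^ r) * theta (q ^ p) (q ^ s) * theta (q ^ p) (q ^ t) * theta (q ^ p) (q ^ (r + s + t)))"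
      unfolding e(1) by (rule mult_divide_mult_cancel_left) (simp add: e(2))
    finally show ?thesis
      by (simp only: power_add)
  qed
  finally show ?thesis .
qed

section \<open>The product of theta values over half of the residues\<close>

lemma prod_qpoch_inf_residues:
  assumes q: "norm q < 1" and p: "p > 0"
  shows "(\<Prod>j<p. qpoch_inf (q ^ Suc j) (q ^ p)) = qpoch_inf q q"
proof (rule LIMSEQ_unique)
  have "norm (q ^ p) < 1" by (rule norm_power_less_one[OF q p])
  thus "(\<lambda>N. \<Prod>j<p. \<Prod>k<N. 1 - q ^ Suc j * (q ^ p) ^ k) \<longlonglongrightarrow> (\<Prod>j<p. qpoch_inf (q ^ Suc j) (q ^ p))"
    by (intro tendsto_prod qpoch_inf_LIMSEQ)
  have "(\<lambda>N. \<Prod>j<N. 1 - q * q ^ j) \<longlonglongrightarrow> qpoch_inf q q"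
    by (rule qpoch_inf_LIMSEQ[OF q])
  \<comment> \<open>Truncating each residue class at N factors amounts to N p factors of the full
    product, so the limit is taken along this subsequence.\<close>
  hence "(\<lambda>N. \<Prod>j<N * p. 1 - q * q ^ j) \<longlonglongrightarrow> qpoch_inf q q"
    by (rule filterlim_compose[where g = "\<lambda>N. \<Prod>j<N. 1 - q * q ^ j"])
       (use p in \<open>auto intro!: mult_nat_right_at_top\<close>)
  also have "(\<lambda>N. \<Prod>j<N * p. 1 - q * q ^ j) = (\<lambda>N. \<Prod>j<p. \<Prod>k<N. 1 - q ^ Suc j * (q ^ p) ^ k)"
  proof
    fix N
    have "(\<Prod>j<N * p. 1 - q * q ^ j) = (\<Prod>k<N. \<Prod>j\<in>{k * p..<k * p + p}. 1 - q * q ^ j)"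
      by (rule prod.nat_group[symmetric])
    also have "\<dots> = (\<Prod>k<N. \<Prod>j<p. 1 - q ^ Suc j * (q ^ p) ^ k)"
    proof (rule prod.cong[OF refl])
      fix k
      show "(\<Prod>j\<in>{k * p..<k * p + p}. 1 - q * q ^ j) = (\<Prod>j<p. 1 - q ^ Suc j * (q ^ p) ^ k)"
        by (rule prod.reindex_bij_witness[of _ "\<lambda>j. j + k * p" "\<lambda>j. j - k * p"])
           (auto simp: power_add[symmetric] power_mult[symmetric] algebra_simps simp flip: power_Suc)
    qed
    also have "\<dots> = (\<Prod>j<p. \<Prod>k<N. 1 - q ^ Suc j * (q ^ p) ^ k)"
      by (rule prod.swap)
    finally show "(\<Prod>j<N * p. 1 - q * q ^ j) = (\<Prod>j<p. \<Prod>k<N. 1 - q ^ Suc j * (q ^ p) ^ k)" .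
  qed
  finally show "(\<lambda>N. \<Prod>j<p. \<Prod>k<N. 1 - q ^ Suc j * (q ^ p) ^ k) \<longlonglongrightarrow> qpoch_inf q q" .
qed

lemma prod_pair_reflect:
  fixes f :: "nat \<Rightarrow> 'a :: comm_monoid_mult"
  shows "(\<Prod>j<2 * h. f (Suc j)) = (\<Prod>j=1..h. f j * f (2 * h + 1 - j))"
proof -
  have "(\<Prod>j<2 * h. f (Suc j)) = (\<Prod>j\<in>{1..h} \<union> {h + 1..2 * h}. f j)"
    by (rule prod.reindex_bij_witness[of _ "\<lambda>j. j - 1" Suc]) auto
  also have "\<dots> = (\<Prod>j=1..h. f j) * (\<Prod>j=h + 1..2 * h. f j)"
    by (rule prod.union_disjoint) auto
  also have "(\<Prod>j=h + 1..2 * h. f j) = (\<Prod>j=1..h. f (2 * h + 1 - j))"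
    by (rule prod.reindex_bij_witness[of _ "\<lambda>j. 2 * h + 1 - j" "\<lambda>j. 2 * h + 1 - j"]) auto
  finally show ?thesis by (simp add: prod.distrib)
qed

context odd_prime
begin

text \<open>The factors of (q; q) are grouped by residue: the classes of j and p - j combine to one
  theta value, and the class of p is left over.\<close>

lemma prod_theta:
  assumes q: "norm q < 1" "q \<noteq> 0"
  shows "(\<Prod>j=1..h. theta (q ^ p) (q ^ j)) * qpoch_inf (q ^ p) (q ^ p) = qpoch_inf q q"
proof -
  have "qpoch_inf q q = (\<Prod>j<2 * h. qpoch_inf (q ^ Suc j) (q ^ p)) * qpoch_inf (q ^ p) (q ^ p)"
  proof -
    have p: "p = Suc (2 * h)"
      using p_eq by linarith
    have "qpoch_inf q q = (\<Prod>j<Suc (2 * h). qpoch_inf (q ^ Suc j) (q ^ p))"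
      unfolding p[symmetric] by (rule prod_qpoch_inf_residues[symmetric]) (use q p_gt_2 in auto)
    thus ?thesis
      unfolding prod.lessThan_Suc unfolding p[symmetric] .
  qed
  also have "(\<Prod>j<2 * h. qpoch_inf (q ^ Suc j) (q ^ p)) = (\<Prod>j=1..h. theta (q ^ p) (q ^ j))"
    unfolding prod_pair_reflect[of "\<lambda>j. qpoch_inf (q ^ j) (q ^ p)"]
  proof (rule prod.cong[OF refl])
    fix j assume "j \<in> {1..h}"
    hence "q ^ (2 * h + 1 - j) = q ^ p / q ^ j"
      unfolding p_eq[symmetric] using q p_eq by (intro power_diff) auto
    thus "qpoch_inf (q ^ j) (q ^ p) * qpoch_inf (q ^ (2 * h + 1 - j)) (q ^ p) = theta (q ^ p) (q ^ j)"
      by (simp add: theta_def)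
  qed
  finally show ?thesis ..
qed

text \<open>The origin of \<open>delta\<close>: the numbers j (j - p) / p for j up to h = (p - 1) /
  2 sum to -h (h + 1) / 3, and h (h + 1) / 6 = (p^2 - 1) / 24.\<close>

lemma prod_klein:
  assumes \<tau>: "Im \<tau> > 0" and dvd: "24 dvd p\<^sup>2 - 1"
  defines "q \<equiv> nome \<tau>"
  shows "q ^ delta p * qpoch_inf (q ^ p) (q ^ p) * (\<Prod>j=1..h. klein p \<tau> j) = qpoch_inf q q"
proof -
  have q: "norm q < 1" "q \<noteq> 0"
    using norm_nome_less_one[OF \<tau>] nome_nonzero by (simp_all add: q_def)
  let ?e = "\<lambda>m. of_nat m * (of_nat m - of_nat p) / of_nat p :: complex"
  have sum: "(\<Sum>j=1..n. of_nat j * (of_nat j - c)) = of_nat n * (of_nat n + 1) * (2 * of_nat n + 1 - 3 * c) / (6 :: complex)" for n c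
    by (induction n) (simp_all add: field_simps)
  have "(\<Sum>j=1..h. ?e j) = (\<Sum>j=1..h. of_nat j * (of_nat j - of_nat p)) / (of_nat p :: complex)"
    by (simp add: sum_divide_distrib)
  also have "\<dots> = - (of_nat h * (of_nat h + 1) / 3)"
  proof -
    have "of_nat p \<noteq> (0 :: complex)"
      using p_gt_2 by simp
    moreover have "2 * of_nat h + 1 - 3 * of_nat p = (- 2 * of_nat p :: complex)"
      by (simp add: of_nat_p)
    ultimately show ?thesis
      unfolding sum by (simp add: field_simps)
  qed
  also have "of_nat h * (of_nat h + 1) / 3 = (2 * of_nat (delta p) :: complex)"
  proof -
    have "24 * delta p = p\<^sup>2 - 1"
      using dvd by (simp add: delta_def)
    also have "p\<^sup>2 = 4 * h * (h + 1) + 1"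
      using arg_cong[OF p_eq, of "\<lambda>n. n\<^sup>2"] by (simp add: power2_eq_square algebra_simps)
    finally have "6 * delta p = h * (h + 1)"
      by simp
    hence "of_nat h * (of_nat h + 1) = (of_nat (6 * delta p) :: complex)"
      by (simp add: distrib_left)
    thus ?thesis by simp
  qed
  finally have e: "(\<Sum>j=1..h. ?e j) = - (2 * of_nat (delta p))" .
  have "(\<Prod>j=1..h. klein p \<tau> j) = exp (of_real pi * \<i> * \<tau> * (\<Sum>j=1..h. ?e j)) * (\<Prod>j=1..h. theta (q ^ p) (q ^ j))"
    unfolding klein_def q_def prod.distrib sum_distrib_left by (simp only: exp_sum[symmetric] finite_atLeastAtMost)
  hence "q ^ delta p * (\<Prod>j=1..h. klein p \<tau> j) = (\<Prod>j=1..h. theta (q ^ p) (q ^ j))"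
    unfolding e q_def nome_power by (simp add: exp_minus mult_ac)
  hence "q ^ delta p * (\<Prod>j=1..h. klein p \<tau> j) * qpoch_inf (q ^ p) (q ^ p) = qpoch_inf q q"
    by (simp only: prod_theta[OF q])
  thus ?thesis
    by (simp only: mult_ac)
qed

end

section \<open>Reduction of indices and the finite certificate\<close>

lemma klein_reduce:
  assumes "Im \<tau> > 0" "p > 0"
  shows "klein p \<tau> m = (- 1) ^ (m div p) * klein p \<tau> (min (m mod p) (p - m mod p))"
proof -
  have "klein p \<tau> m = (- 1) ^ (m div p) * klein p \<tau> (m mod p)"
  proof (induction m rule: less_induct)
    case (less m)
    show ?case
    proof (cases "m < p")
      case False
      hence "klein p \<tau> m = - klein p \<tau> (m - p)"
        using assms by (intro klein_minus_period) auto
      also have "klein p \<tau> (m - p) = (- 1) ^ ((m - p) div p) * klein p \<tau> ((m - p) mod p)"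
        using False assms by (intro less) auto
      finally show ?thesis
        using False assms by (simp add: le_mod_geq le_div_geq)
    qed auto
  qed
  also have "klein p \<tau> (m mod p) = klein p \<tau> (min (m mod p) (p - m mod p))"
    using klein_reflect[OF assms(1), of "m mod p" p] assms(2) by (simp add: min_def)
  finally show ?thesis .
qed

text \<open>\<open>sawtooth\<close> scaled by 2 p, so that the relation becomes integer arithmetic
  that can be evaluated.\<close>

definition sawtooth_int :: "nat \<Rightarrow> nat \<Rightarrow> int" where
  "sawtooth_int p m = (if m mod p = 0 then 0 else int p - 2 * int (m mod p))"

lemma sawtooth_eq_int:
  assumes "p > 0"
  shows "sawtooth p (int m) = of_int (sawtooth_int p m) / (2 * of_nat p)"
proof -
  have "int p dvd int m \<longleftrightarrow> m mod p = 0"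
    unfolding int_dvd_int_iff by (rule dvd_eq_mod_eq_0)
  moreover have "(of_int (int m mod int p) :: complex) = of_nat (m mod p)"
    by (metis of_int_of_nat_eq of_nat_mod)
  ultimately show ?thesis
    using assms by (simp add: sawtooth_def sawtooth_int_def field_simps)
qed

text \<open>The third and fourth conditions say that for each multiplier \<open>m\<close> the products \<open>u m\<close> run over all
  residues up to sign, and that the signs picked up by \<open>klein_reduce\<close> cancel.\<close>

definition triple_certificate :: "nat \<Rightarrow> nat \<Rightarrow> nat \<Rightarrow> nat \<Rightarrow> int list \<Rightarrow> nat list \<Rightarrow> bool" where
  "triple_certificate p r s t as us \<longleftrightarrow>
     list_all (\<lambda>d. sawtooth_int p (d * r) + sawtooth_int p (d * s) + sawtooth_int p (d * t)
         - sawtooth_int p (d * (r + s + t)) =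
         (if d = 1 then 2 * int p else if d = p - 1 then - 2 * int p else 0)) [1..<p] \<and>
     list_all2 (\<lambda>a u. (a * int u) mod int p = 1) as us \<and>
     list_all (\<lambda>m. m mod p \<noteq> 0 \<and>
         sort (map (\<lambda>u. min ((u * m) mod p) (p - (u * m) mod p)) us) = [1..<Suc ((p - 1) div 2)])
       [r, s, t, r + s, s + t, r + t, r + s + t] \<and>
     even (sum_list (map (\<lambda>m. sum_list (map (\<lambda>u. (u * m) div p) us))
       [r, s, t, r + s, s + t, r + t, r + s + t]))"

context odd_prime
begin

lemma sawtooth_relationI:
  assumes "triple_certificate p r s t as us"
  shows "sawtooth_relation r s t"
  unfolding sawtooth_relation_def
proof
  fix d assume d: "d \<in> {1..<int p}"
  define e where "e = nat d"
  have e: "d = int e" "e \<in> set [1..<p]"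
    using d by (auto simp: e_def)
  have "sawtooth_int p (e * r) + sawtooth_int p (e * s) + sawtooth_int p (e * t)
         - sawtooth_int p (e * (r + s + t)) =
         (if e = 1 then 2 * int p else if e = p - 1 then - 2 * int p else 0)"
    using assms e(2) unfolding triple_certificate_def list_all_iff by blast
  hence "of_int (sawtooth_int p (e * r) + sawtooth_int p (e * s) + sawtooth_int p (e * t)
         - sawtooth_int p (e * (r + s + t))) / (2 * of_nat p) =
         (of_int (if e = 1 then 2 * int p else if e = p - 1 then - 2 * int p else 0) / (2 * of_nat p) :: complex)"
    by (simp only:)
  also have "\<dots> = of_bool (d = 1) - of_bool (d = int p - 1)"
    using p_gt_2 e by (auto simp: of_nat_diff)
  finally show "sawtooth p (d * int r) + sawtooth p (d * int s) + sawtooth p (d * int t)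
       - sawtooth p (d * int (r + s + t)) = of_bool (d = 1) - of_bool (d = int p - 1)"
    using p_gt_2 unfolding e(1) of_nat_mult[symmetric]
    by (simp only: sawtooth_eq_int of_int_add of_int_diff add_divide_distrib diff_divide_distrib)
qed

lemma theta_quotient_product:
  assumes \<tau>: "Im \<tau> > 0" and dvd: "24 dvd p\<^sup>2 - 1" and len: "length as = h"
    and cert: "triple_certificate p r s t as us"
  defines "q \<equiv> nome \<tau>"
  shows "q ^ delta p * (qpoch_inf (q ^ p) (q ^ p) ^ p / qpoch_inf q q) =
     (\<Prod>k=1..h. eisenstein_res (as ! (k - 1)) p \<tau>)"
proof -
  have q: "norm q < 1" "q \<noteq> 0"
    using norm_nome_less_one[OF \<tau>] nome_nonzero by (simp_all add: q_def)
  have p0: "p > 0" using p_gt_2 by simp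
  define Q where "Q = qpoch_inf (q ^ p) (q ^ p)"
  define K where "K = (\<Prod>j=1..h. klein p \<tau> j)"
  let ?k = "klein p \<tau>"
  let ?M = "{r, s, t, r + s, s + t, r + t, r + s + t}"
  have cop: "\<not> p dvd m" if "m \<in> ?M" for m
    using cert that by (auto simp: triple_certificate_def dvd_eq_mod_eq_0)
  have us: "list_all2 (\<lambda>a u. [a * int u = 1] (mod int p)) as us"
    using cert p_gt_2 by (simp add: triple_certificate_def cong_def)
  have Knz: "K \<noteq> 0"
    unfolding K_def
  proof (subst prod_zero_iff; clarsimp)
    fix j assume j: "Suc 0 \<le> j" "j \<le> h" "?k j = 0"
    hence "p dvd j"
      using klein_nonzero[OF \<tau> p0] by blast
    thus False using j p_eq by (auto dest: dvd_imp_le)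
  qed
  have coprime: "coprime m p" if "m \<in> ?M" for m
    using prime_imp_coprime[OF prime cop[OF that]] by (simp add: coprime_commute)
  have E: "eisenstein_res a p \<tau> = Q\<^sup>2 * ?k (u * (r + s)) * ?k (u * (s + t)) * ?k (u * (r + t)) /
      (?k (u * r) * ?k (u * s) * ?k (u * t) * ?k (u * (r + s + t)))" if u: "[a * int u = 1] (mod int p)" for a u
  proof -
    have "coprime (int u) (int p)"
      using u by (metis cong_imp_coprime cong_sym coprime_1_left coprime_mult_left_iff)
    hence "\<not> p dvd u"
      by (simp add: coprime_iff)
    hence nd: "\<not> p dvd u * m" if "m \<in> ?M" for m
      using cop[OF that] prime by (simp add: prime_dvd_mult_iff)
    have "eisenstein_res a p \<tau> = lambert_res p q (int (u * r)) + lambert_res p q (int (u * s)) +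
        lambert_res p q (int (u * t)) - lambert_res p q (int (u * (r + s + t)))"
      unfolding q_def
      by (rule eisenstein_res_eq_lambert[OF \<tau> sawtooth_relationI[OF cert] _ _ _ _ u]) (rule coprime; simp)+
    also have "u * (r + s + t) = u * r + u * s + u * t"
      by (simp add: algebra_simps)
    also have "lambert_res p q (int (u * r)) + lambert_res p q (int (u * s)) +
        lambert_res p q (int (u * t)) - lambert_res p q (int (u * r + u * s + u * t)) =
        Q\<^sup>2 * ?k (u * r + u * s) * ?k (u * s + u * t) * ?k (u * r + u * t) /
      (?k (u * r) * ?k (u * s) * ?k (u * t) * ?k (u * r + u * s + u * t))"
      unfolding Q_def q_def
      by (rule klein_addition[OF \<tau> p0]; (unfold distrib_left[symmetric])?; rule nd; simp)
    finally show ?thesis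
      by (simp only: distrib_left)
  qed
  define P where "P = (\<lambda>m. prod_list (map (\<lambda>u. ?k (u * m)) us))"
  define N where "N = (\<lambda>m. sum_list (map (\<lambda>u. (u * m) div p) us))"
  have P: "P m = (- 1) ^ N m * K" if m: "m \<in> ?M" for m
  proof -
    let ?f = "\<lambda>u. min ((u * m) mod p) (p - (u * m) mod p)"
    have "P m = prod_list (map (\<lambda>u. (- 1) ^ ((u * m) div p) * ?k (?f u)) us)"
      unfolding P_def by (subst klein_reduce[OF \<tau> p0]) simp
    also have "\<dots> = (- 1) ^ N m * prod_list (map ?k (map ?f us))"
      unfolding N_def by (induction us) (simp_all add: power_add mult_ac)
    \<comment> \<open>Sorting leaves the product unchanged and lets the certificate state equality
      of multisets as equality of lists.\<close>
    also have "prod_list (map ?k (map ?f us)) = prod_list (map ?k (sort (map ?f us)))"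
      by (simp only: prod_mset_prod_list[symmetric] mset_map mset_sort)
    also have "sort (map ?f us) = [1..<Suc h]"
      using cert m unfolding triple_certificate_def list_all_iff list.set h_def by blast
    also have "prod_list (map ?k [1..<Suc h]) = K"
      using prod.distinct_set_conv_list[of "[1..<Suc h]" ?k]
      by (simp only: K_def distinct_upt set_upt atLeastLessThanSuc_atLeastAtMost)
    finally show ?thesis .
  qed
  have len': "length us = h"
    using us len by (auto dest: list_all2_lengthD)
  have "(\<Prod>k=1..h. eisenstein_res (as ! (k - 1)) p \<tau>) = (\<Prod>k<h. eisenstein_res (as ! k) p \<tau>)"
    by (rule prod.reindex_bij_witness[of _ Suc "\<lambda>k. k - 1"]) auto
  also have "\<dots> = prod_list (map (\<lambda>a. eisenstein_res a p \<tau>) as)"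
    using len by (simp add: prod.list_conv_set_nth atLeast0LessThan)
  also have "\<dots> = Q ^ (2 * length us) * P (r + s) * P (s + t) * P (r + t) / (P r * P s * P t * P (r + s + t))"
    using us unfolding P_def
  proof (induction rule: list_all2_induct)
    case (Cons a as u us)
    show ?case
      unfolding list.map prod_list.Cons E[OF Cons(1)] Cons(3) times_divide_times_eq
      by (simp add: power2_eq_square mult_ac)
  qed simp
  also have "\<dots> = Q ^ (2 * h) * ((- 1) ^ (N (r + s) + N (s + t) + N (r + t)) * K ^ 3) /
      ((- 1) ^ (N r + N s + N t + N (r + s + t)) * K ^ 4)"
    unfolding len' by (simp add: P power_add power3_eq_cube power4_eq_xxxx mult_ac)
  \<comment> \<open>Only the total sign of all seven products is controlled. That suffices, because
    a sign is its own inverse and may be moved across the fraction.\<close>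
  also have "\<dots> = Q ^ (2 * h) / K"
  proof -
    have parity: "(- 1 :: complex) ^ m = (- 1) ^ n" if "even (m + n)" for m n :: nat
      using that by (auto simp: minus_one_power_iff)
    have "even (sum_list (map N [r, s, t, r + s, s + t, r + t, r + s + t]))"
      using cert unfolding triple_certificate_def N_def by (elim conjE)
    hence "even (N (r + s) + N (s + t) + N (r + t) + (N r + N s + N t + N (r + s + t)))"
      by (simp only: list.map sum_list.Cons sum_list.Nil add_0_left add_0_right add_ac)
    hence "(- 1 :: complex) ^ (N (r + s) + N (s + t) + N (r + t)) = (- 1) ^ (N r + N s + N t + N (r + s + t))"
      by (rule parity)
    thus ?thesis
      using Knz by (simp add: field_simps power3_eq_cube power4_eq_xxxx)
  qed
  also have "\<dots> = q ^ delta p * (Q ^ p / qpoch_inf q q)"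
  proof -
    \<comment> \<open>The extra factor Q from the class of p raises the exponent 2 h = p - 1 to
      p.\<close>
    have "qpoch_inf q q = q ^ delta p * Q * K"
      using prod_klein[OF \<tau> dvd] by (simp add: q_def Q_def K_def)
    moreover have "Q \<noteq> 0"
      unfolding Q_def by (rule qpoch_inf_self_nonzero[OF norm_power_less_one[OF q(1) p0]])
    moreover have "Q ^ p = Q ^ (2 * h) * Q"
      using arg_cong[OF p_eq, of "\<lambda>n. Q ^ n"] by (simp only: power_add power_one_right)
    ultimately show ?thesis
      using Knz q by simp
  qed
  finally show ?thesis
    unfolding Q_def ..
qed

end

theorem theorem4p1:
  fixes p :: nat and \<tau> :: complex
  assumes "prime p" and "5 \<le> p" and "p \<le> 19" and "Im \<tau> > 0"
  shows "nome \<tau> ^ delta p *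
           (qpoch_inf (nome \<tau> ^ p) (nome \<tau> ^ p) ^ p / qpoch_inf (nome \<tau>) (nome \<tau>))
         = (\<Prod>k=1..(p - 1) div 2. eisenstein_res (residue_tuple p ! (k - 1)) p \<tau>)"
proof -
  interpret odd_prime p
    using assms by unfold_locales auto
  have main: ?thesis if "24 dvd p\<^sup>2 - 1" "length (residue_tuple p) = (p - 1) div 2"
      "triple_certificate p r s t (residue_tuple p) us" for r s t us
    using theta_quotient_product[OF assms(4) that(1) _ that(3)] that(2) unfolding h_def by blast
  have "p = 5 \<or> p = 6 \<or> p = 7 \<or> p = 8 \<or> p = 9 \<or> p = 10 \<or> p = 11 \<or> p = 12 \<or> p = 13 \<or>
      p = 14 \<or> p = 15 \<or> p = 16 \<or> p = 17 \<or> p = 18 \<or> p = 19"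
    using assms(2,3) by presburger
  hence "p = 5 \<or> p = 7 \<or> p = 11 \<or> p = 13 \<or> p = 17 \<or> p = 19"
    using assms(1) by (elim disjE) simp_all
  then consider "p = 5" | "p = 7" | "p = 11" | "p = 13" | "p = 17" | "p = 19"
    by blast
  \<comment> \<open>In each case the list holds the inverses modulo p of the tuple entries, in
    order, and the triple solves the carry condition of \<open>sawtooth_relation\<close>. Replacing
    an entry a by -a would flip the sign of its factor, so the parity check does depend on the
    representatives chosen in the tuple.\<close>
  thus ?thesis
  proof cases
    case 1
    show ?thesis
      by (rule main[of 1 1 1 "[1, 3]"]; unfold 1; code_simp)
  next
    case 2
    show ?thesis
      by (rule main[of 1 1 2 "[1, 4, 5]"]; unfold 2; code_simp)
  next
    case 3
    show ?thesis
      by (rule main[of 1 2 3 "[1, 6, 4, 9, 8]"]; unfold 3; code_simp)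
  next
    case 4
    show ?thesis
      by (rule main[of 1 3 4 "[1, 7, 9, 10, 8, 2]"]; unfold 4; code_simp)
  next
    case 5
    show ?thesis
      by (rule main[of 2 3 5 "[1, 9, 6, 7, 5, 15, 14, 4]"]; unfold 5; code_simp)
  next
    case 6
    show ?thesis
      by (rule main[of 3 4 5 "[1, 10, 13, 5, 4, 11, 17, 7, 3]"]; unfold 6; code_simp)
  qed
qed

end
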